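(* Let $m\ge 1$, let $u=(u_1,\ldots,u_m)\in S^{2m-1}$, let $f$ be a non-constant entire function in $\mathbb{C}^m$, and let $n\geq 2$ be an integer such that $\partial_u(f^n)\not\equiv 0$. If $f^n$ and $\partial_u(f^n)$ share $1$ IM, then $f\equiv n\,\partial_u(f)$. In particular, if $u_j=1$ for some $j$ and $u_i=0$ for all $i\neq j$, then \[f(z)=e^{z_j/n+\alpha(z)},\] where $\alpha(z)=\alpha(z_1,\ldots,z_{j-1},z_{j+1},\ldots,z_m)$ is a non-constant entire function in $\mathbb{C}^{m-1}$.
   Context: $S^{2m-1}=\{(u_1,\ldots,u_m)\in\mathbb{C}^m:|u_1|^2+\cdots+|u_m|^2=1\}$. For $u\in S^{2m-1}$ the directional derivative of $f$ along $u$ is $\partial_u(f)=\sum_{j=1}^m u_j\,\partial f/\partial z_j$. For a holomorphic function $g\not\equiv 0$ near a point $a\in\mathbb{C}^m$, expand $g(z)=\sum_{i\ge 0}P_i(z-a)$ with $P_i$ either identically zero or a homogeneous polynomial of degree $i$; the zero multiplicity of $g$ at $a$ is $\mu_g^0(a)=\min\{i:P_i\not\equiv 0\}$. Two entire functions $F,G$ on $\mathbb{C}^m$ share the value $1$ IM (ignoring multiplicities) if $\min\{\mu^0_{F-1},1\}=\min\{\mu^0_{G-1},1\}$ on $\mathbb{C}^m$, i.e. $F-1$ and $G-1$ have the same zero set.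
   Formalization: The closing formula fails for f = z_2 e^{z_1/2} (n=2) and f = e^{z_j/n}. Proved instead: f = e^{z_j/n} h with h entire and independent of z_j; f = e^{z_j/n+α} only if f has no zeros; α non-constant only if f is not c e^{z_j/n}. *)

theory Defs
  imports "HOL-Analysis.Analysis" "HOL-Library.Extended_Nat"
begin

text \<open>
  \<open>\<complex>\<^sup>m\<close> is \<^typ>\<open>complex ^ 'm\<close> with \<open>m = CARD('m) \<ge> 1\<close>; \<open>*s\<close> is scalar multiplication by
  complex numbers, and \<open>axis j 1\<close> is the j-th standard basis vector.
\<close>

definition complex_sphere :: "(complex ^ 'm::finite) set" where
  "complex_sphere = {u. (\<Sum>j\<in>UNIV. (cmod (u $ j))\<^sup>2) = 1}"

text \<open>\<^const>\<open>has_derivative\<close> only provides a real-linear derivative, hence the second conjunct.\<close>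

definition entire :: "(complex ^ 'm::finite \<Rightarrow> complex) \<Rightarrow> bool" where
  "entire f \<longleftrightarrow>
     (\<forall>z. \<exists>D. (f has_derivative D) (at z) \<and> (\<forall>c v. D (c *s v) = c * D v))"

definition partial_deriv :: "'m \<Rightarrow> (complex ^ 'm::finite \<Rightarrow> complex) \<Rightarrow> complex ^ 'm \<Rightarrow> complex" where
  "partial_deriv j f z = deriv (\<lambda>t. f (z + t *s axis j 1)) 0"

definition dir_deriv ::
    "complex ^ 'm::finite \<Rightarrow> (complex ^ 'm \<Rightarrow> complex) \<Rightarrow> complex ^ 'm \<Rightarrow> complex" where
  "dir_deriv u f z = (\<Sum>j\<in>UNIV. u $ j * partial_deriv j f z)"

text \<open>
  The coefficients \<open>c\<close> are indexed by the (finitely many) multi-indices of total degree \<open>d\<close>.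
  The zero polynomial is homogeneous of every degree.
\<close>

definition homogeneous_poly :: "nat \<Rightarrow> (complex ^ 'm::finite \<Rightarrow> complex) \<Rightarrow> bool" where
  "homogeneous_poly d P \<longleftrightarrow>
     (\<exists>c. \<forall>w. P w = (\<Sum>k\<in>{k :: 'm \<Rightarrow> nat. (\<Sum>i\<in>UNIV. k i) = d}. c k * (\<Prod>i\<in>UNIV. w $ i ^ k i)))"

definition homogeneous_expansion ::
    "(complex ^ 'm::finite \<Rightarrow> complex) \<Rightarrow> complex ^ 'm \<Rightarrow> (nat \<Rightarrow> complex ^ 'm \<Rightarrow> complex) \<Rightarrow> bool" where
  "homogeneous_expansion g a P \<longleftrightarrow>
     (\<forall>i. homogeneous_poly i (P i)) \<and> (\<forall>\<^sub>F z in nhds a. (\<lambda>i. P i (z - a)) sums g z)"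

lemma homogeneous_poly_scale:
  assumes "homogeneous_poly d P"
  shows "P (t *s w) = t ^ d * P w"
proof -
  from assms obtain c where c: "\<And>w. P w =
      (\<Sum>k\<in>{k :: 'a \<Rightarrow> nat. (\<Sum>i\<in>UNIV. k i) = d}. c k * (\<Prod>i\<in>UNIV. w $ i ^ k i))"
    unfolding homogeneous_poly_def by blast
  show ?thesis unfolding c sum_distrib_left
  proof (rule sum.cong[OF refl])
    fix k :: "'a \<Rightarrow> nat" assume "k \<in> {k. (\<Sum>i\<in>UNIV. k i) = d}"
    then have "(\<Prod>i\<in>UNIV. t ^ k i) = t ^ d" by (simp add: power_sum[symmetric])
    then show "c k * (\<Prod>i\<in>UNIV. (t *s w) $ i ^ k i) = t ^ d * (c k * (\<Prod>i\<in>UNIV. w $ i ^ k i))"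
      by (simp add: power_mult_distrib prod.distrib)
  qed
qed

lemma homogeneous_expansion_unique:
  assumes P: "homogeneous_expansion g a P" and Q: "homogeneous_expansion g a Q"
  shows "P = Q"
proof (intro ext)
  fix n and w :: "complex ^ 'a"
  have "continuous_on UNIV (\<lambda>t::complex. a + t *s w)"
    by (auto simp: continuous_on_vec_lambda vector_scalar_mult_def intro!: continuous_intros)
  then have lim: "filterlim (\<lambda>t::complex. a + t *s w) (nhds a) (nhds 0)"
  proof -
    assume "continuous_on UNIV (\<lambda>t::complex. a + t *s w)"
    then have "isCont (\<lambda>t::complex. a + t *s w) 0"
      by (simp add: continuous_on_eq_continuous_at)
    then show ?thesis
      using tendsto_at_iff_tendsto_nhds[of "\<lambda>t::complex. a + t *s w" 0] by (simp add: isCont_def)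
  qed
  have "\<forall>\<^sub>F z in nhds a. (\<lambda>i. P i (z - a)) sums g z \<and> (\<lambda>i. Q i (z - a)) sums g z"
    using P Q by (auto simp: homogeneous_expansion_def intro: eventually_conj)
  then have "\<forall>\<^sub>F t in nhds 0. (\<lambda>i. P i (t *s w)) sums g (a + t *s w)
      \<and> (\<lambda>i. Q i (t *s w)) sums g (a + t *s w)"
    using filterlim_iff[THEN iffD1, OF lim] by fastforce
  moreover have "P i (t *s w) = t ^ i * P i w" "Q i (t *s w) = t ^ i * Q i w" for i t
    using P Q by (auto simp: homogeneous_expansion_def homogeneous_poly_scale)
  ultimately have "\<forall>\<^sub>F t in nhds 0. (\<lambda>i. (P i w - Q i w) * t ^ i) sums 0"
    by (auto elim!: eventually_mono dest: sums_diff simp: algebra_simps)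
  then obtain e where e: "e > 0"
      "\<And>t. norm t < e \<Longrightarrow> (\<lambda>i. (P i w - Q i w) * t ^ i) sums 0"
    by (auto simp: eventually_nhds_metric)
  show "P n w = Q n w"
  proof (rule ccontr)
    assume "P n w \<noteq> Q n w"
    define k where "k = (LEAST k. P k w \<noteq> Q k w)"
    have k: "P k w \<noteq> Q k w" unfolding k_def by (rule LeastI) fact
    have below: "P i w = Q i w" if "i < k" for i using not_less_Least that k_def by blast
    have shifted: "(\<lambda>i. (P (i + k) w - Q (i + k) w) * t ^ i) sums 0" if "norm t < e" "t \<noteq> 0" for t
    proof -
      have "(\<lambda>i. (P (i + k) w - Q (i + k) w) * t ^ (i + k)) sums 0"
        using sums_split_initial_segment[OF e(2)[OF that(1)], of k] below by simp
      then have "(\<lambda>i. inverse (t ^ k) * ((P (i + k) w - Q (i + k) w) * t ^ (i + k))) sums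
          (inverse (t ^ k) * 0)"
        by (rule sums_mult)
      moreover have "inverse (t ^ k) * (x * t ^ (i + k)) = x * t ^ i" for x i
        using that(2) by (simp add: power_add)
      ultimately show ?thesis by simp
    qed
    have "((\<lambda>t. 0) \<longlongrightarrow> P (0 + k) w - Q (0 + k) w) (at (0::complex))"
      using powser_limit_0_strong[where s = e and f = "\<lambda>t. 0"
          and a = "\<lambda>i. P (i + k) w - Q (i + k) w"] e(1) shifted by auto
    from LIM_unique[OF this tendsto_const] have "P k w - Q k w = 0" by simp
    with k show False by simp
  qed
qed

text \<open>
  By uniqueness of the expansion the choice operator is harmless. The multiplicity is \<open>\<infinity>\<close> (infimum of
  the empty set) exactly when the expansion vanishes identically.
\<close>

definition zero_mult :: "(complex ^ 'm::finite \<Rightarrow> complex) \<Rightarrow> complex ^ 'm \<Rightarrow> enat" where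
  "zero_mult g a =
     Inf (enat ` {i. \<exists>w. (SOME P. homogeneous_expansion g a P) i w \<noteq> 0})"

definition share_IM ::
    "(complex ^ 'm::finite \<Rightarrow> complex) \<Rightarrow> (complex ^ 'm \<Rightarrow> complex) \<Rightarrow> complex \<Rightarrow> bool" where
  "share_IM F G c \<longleftrightarrow>
     (\<forall>a. min (zero_mult (\<lambda>z. F z - c) a) 1 = min (zero_mult (\<lambda>z. G z - c) a) 1)"

text \<open>
  An entire function in the variables \<open>z\<^sub>i\<close>, \<open>i \<noteq> j\<close>, is encoded as an entire function on the whole space
  that does not depend on \<open>z\<^sub>j\<close>. For \<open>m = 1\<close> these are the constants.
\<close>

definition indep_of_coord :: "'m \<Rightarrow> (complex ^ 'm::finite \<Rightarrow> complex) \<Rightarrow> bool" where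
  "indep_of_coord j h \<longleftrightarrow> (\<forall>z w. (\<forall>i. i \<noteq> j \<longrightarrow> z $ i = w $ i) \<longrightarrow> h z = h w)"

end

theory Submission
  imports Defs "HOL-Complex_Analysis.Complex_Analysis"
begin

text \<open>
Along a complex line \<open>z + t u\<close> the derivative of \<open>f\<close> in direction \<open>u\<close> is the ordinary derivative of
\<open>g t = f (z + t u)\<close>, so sharing the value 1 becomes a condition on one entire function of one variable:
\<open>g\<^sup>n\<close> takes the value 1 exactly where its derivative does (\<open>share_IM_iff\<close> reads this off from the
truncated multiplicities, once the homogeneous expansions are known to exist). The one-variable theorem
\<open>eq_n_times_derivative\<close> says that such a \<open>g\<close> is constant or satisfies \<open>g = n g'\<close>. In both cases the
product of \<open>\<partial>\<^sub>u f\<close> and \<open>f - n \<partial>\<^sub>u f\<close> vanishes on the line, hence everywhere; entire functions have no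
zero divisors and \<open>\<partial>\<^sub>u f\<close> is not identically zero, so \<open>f = n \<partial>\<^sub>u f\<close>. For the \<open>j\<close>-th basis vector this
says that \<open>f exp (- z\<^sub>j / n)\<close> is independent of \<open>z\<^sub>j\<close>, and if \<open>f\<close> has no zeros that function has an
entire logarithm.

In one variable, every 1-point of \<open>g\<^sup>n\<close> is simple, and \<open>n g' = g\<close> there. Hence
\<open>W = n g\<^sup>n\<^sup>-\<^sup>2 g' (n g' - g) / (g\<^sup>n - 1)\<close> is entire. The heart of the proof is that \<open>W\<close> is bounded and so,
by Liouville, a constant \<open>c\<close> (\<open>ODE_constant_quotient\<close>). This takes two tools.

First, rescaling. If \<open>g'\<close> were not bounded by a multiple of \<open>\<bar>g\<bar> log \<bar>g\<bar>\<close> for large \<open>g\<close> and by a constant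
for bounded \<open>g\<close>, suitably rescaled copies of \<open>g\<close> would converge to a nonconstant entire \<open>G\<close>. Under
rescaling the condition \<open>(g\<^sup>n)' = 1\<close> degenerates to \<open>(G\<^sup>n)' = 0\<close>, and sharing forces \<open>G\<^sup>n\<close> to omit 1,
then its derivative to omit 0, and then, as \<open>n \<ge> 2\<close>, \<open>G\<^sup>n\<close> to omit 0. Picard's theorem rules this out
(\<open>derivative_dominated_by_weight\<close>).

Second, a Harnack estimate. A holomorphic \<open>h\<close> with \<open>0 < \<bar>h\<bar> < 1\<close> on a disc has a logarithm in a half-plane,
so \<open>h'/h\<close> at the centre is controlled by the size of \<open>h\<close> at any point at a fixed depth below the
boundary (\<open>log_deriv_bound\<close>). Taking the largest disc on which \<open>1/g\<close>, respectively \<open>g\<^sup>n - 1\<close>, is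
nonzero and stays below a fixed bound, and what is known near its boundary, one obtains \<open>\<bar>g'\<bar> \<le> C \<bar>g\<bar>\<close> where \<open>\<bar>g\<bar> \<ge> 1\<close>, and
the estimate for \<open>W\<close> where \<open>g\<^sup>n\<close> is close to 1.

It remains to solve \<open>n g\<^sup>n\<^sup>-\<^sup>2 g' (n g' - g) = c (g\<^sup>n - 1)\<close>. For \<open>c = 0\<close> it gives \<open>g = n g'\<close>. For
\<open>c \<noteq> 0\<close> the equation makes auxiliary entire functions omit two values, and the one family of solutions that
survives Picard's theorem, \<open>g = k e\<^sup>t\<^sup>/\<^sup>4 \<plusminus> 1\<close> with \<open>n = 2\<close>, takes the value \<open>(g\<^sup>2)' = 1\<close> at points where
\<open>g\<^sup>2 = 4\<close>.
\<close>

(* Vector components and coefficients of formal power series compete for the same infix symbol. *)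
no_notation fps_nth (infixl "$" 75)

section \<open>Bounds for logarithmic derivatives\<close>

text \<open>
The Schwarz lemma for maps from a disc into the right half-plane, transported by the Cayley transform that
sends \<open>k a\<close> to 0. The second part is Harnack's inequality for the positive harmonic function \<open>Re k\<close>.
\<close>

lemma half_plane_Schwarz:
  fixes k :: "complex \<Rightarrow> complex"
  assumes hol: "k holomorphic_on ball a R" and R: "R > 0"
    and pos: "\<And>z. z \<in> ball a R \<Longrightarrow> Re (k z) > 0"
  shows "cmod (deriv k a) * R \<le> 2 * Re (k a)"
    and "z \<in> ball a R \<Longrightarrow> Re (k a) * (R - dist a z) \<le> Re (k z) * (R + dist a z)"
proof -
  define q where "q \<zeta> = k (a + of_real R * \<zeta>)" for \<zeta>
  define \<psi> where "\<psi> \<zeta> = (q \<zeta> - k a) / (q \<zeta> + cnj (k a))" for \<zeta>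
  have inb: "a + of_real R * \<zeta> \<in> ball a R" if "norm \<zeta> < 1" for \<zeta> :: complex
    using that R by (simp add: dist_norm norm_mult)
  have posq: "Re (q \<zeta>) > 0" if "norm \<zeta> < 1" for \<zeta>
    unfolding q_def by (rule pos[OF inb[OF that]])
  have ka: "Re (k a) > 0" using R by (intro pos) simp
  have ne: "q \<zeta> + cnj (k a) \<noteq> 0" if "norm \<zeta> < 1" for \<zeta>
  proof -
    have "Re (q \<zeta> + cnj (k a)) > 0" using posq[OF that] ka by simp
    then show ?thesis by force
  qed
  have holq: "q holomorphic_on ball 0 1"
  proof -
    have "(k \<circ> (\<lambda>\<zeta>. a + of_real R * \<zeta>)) holomorphic_on ball 0 1"
      by (rule holomorphic_on_compose_gen[OF _ hol]) (use inb in \<open>auto intro!: holomorphic_intros\<close>)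
    then show ?thesis unfolding q_def o_def .
  qed
  have hol\<psi>: "\<psi> holomorphic_on ball 0 1"
    unfolding \<psi>_def using ne by (intro holomorphic_intros holq) auto
  have \<psi>0: "\<psi> 0 = 0" by (simp add: \<psi>_def q_def)
  have small: "norm (\<psi> \<zeta>) < 1" if "norm \<zeta> < 1" for \<zeta>
  proof -
    \<comment> \<open>\<open>q \<zeta>\<close> is closer to \<open>k a\<close> than to its mirror image, both being in the half-plane\<close>
    have "(norm (q \<zeta> - k a))\<^sup>2 < (norm (q \<zeta> + cnj (k a)))\<^sup>2"
      using posq[OF that] ka unfolding cmod_power2
      by (simp add: power2_eq_square algebra_simps)
    then have "norm (q \<zeta> - k a) < norm (q \<zeta> + cnj (k a))"
      using power2_less_imp_less by fastforce
    then show ?thesis using ne[OF that] by (simp add: \<psi>_def norm_divide)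
  qed
  have "(k has_field_derivative deriv k a) (at a)"
    using holomorphic_derivI[OF hol] R by auto
  then have dq: "(q has_field_derivative deriv k a * of_real R) (at 0)"
    unfolding q_def
    using DERIV_chain2[of k "deriv k a" "\<lambda>\<zeta>. a + of_real R * \<zeta>" 0 "of_real R" UNIV]
    by (force intro!: derivative_eq_intros)
  have q0: "q 0 = k a" by (simp add: q_def)
  have re2: "k a + cnj (k a) = of_real (2 * Re (k a))"
    by (simp add: complex_eq_iff)
  have "(\<psi> has_field_derivative deriv k a * of_real R / of_real (2 * Re (k a))) (at 0)"
    unfolding \<psi>_def using ka
    by (auto intro!: derivative_eq_intros dq simp: q0 re2 field_simps)
  then have "norm (deriv k a * of_real R / of_real (2 * Re (k a))) \<le> 1"
    using Schwarz_Lemma(2)[OF hol\<psi> \<psi>0 small, of 0] by (simp add: DERIV_imp_deriv)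
  then show "cmod (deriv k a) * R \<le> 2 * Re (k a)"
    using ka R by (simp add: norm_mult norm_divide field_simps)
  show "Re (k a) * (R - dist a z) \<le> Re (k z) * (R + dist a z)" if z: "z \<in> ball a R"
  proof -
    define \<zeta> where "\<zeta> = (z - a) / of_real R"
    define s where "s = norm \<zeta>"
    have s: "s = dist a z / R" "0 \<le> s" "s < 1"
      using z R by (auto simp: s_def \<zeta>_def norm_divide dist_norm norm_minus_commute)
    have qz: "q \<zeta> = k z" using R by (simp add: q_def \<zeta>_def)
    have "norm (\<psi> \<zeta>) \<le> s"
      using Schwarz_Lemma(1)[OF hol\<psi> \<psi>0 small, of \<zeta>] s s_def by simp
    then have "norm (k z - k a) \<le> s * norm (k z + cnj (k a))"
      using ne[of \<zeta>] s by (simp add: \<psi>_def qz norm_divide divide_simps s_def split: if_splits)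
    then have "(norm (k z - k a))\<^sup>2 \<le> (s * norm (k z + cnj (k a)))\<^sup>2"
      by (intro power_mono) auto
    then have "(Re (k z) - Re (k a))\<^sup>2 + (Im (k z) - Im (k a))\<^sup>2
        \<le> s\<^sup>2 * ((Re (k z) + Re (k a))\<^sup>2 + (Im (k z) - Im (k a))\<^sup>2)"
      by (simp add: power_mult_distrib cmod_power2)
    moreover have "s\<^sup>2 * (Im (k z) - Im (k a))\<^sup>2 \<le> 1 * (Im (k z) - Im (k a))\<^sup>2"
      using s by (intro mult_right_mono) (auto simp: power_le_one)
    ultimately have "(Re (k a) - Re (k z))\<^sup>2 \<le> s\<^sup>2 * (Re (k z) + Re (k a))\<^sup>2"
      by (simp add: power2_commute algebra_simps)
    then have "(Re (k a) - Re (k z))\<^sup>2 \<le> (s * (Re (k z) + Re (k a)))\<^sup>2"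
      by (simp add: power_mult_distrib)
    then have "Re (k a) - Re (k z) \<le> s * (Re (k z) + Re (k a))"
      using s ka pos[OF z] by (meson power2_le_imp_le add_nonneg_nonneg less_imp_le mult_nonneg_nonneg)
    then show ?thesis using R by (simp add: s field_simps)
  qed
qed

text \<open>
The function \<open>- ln h\<close> maps the disc into the right half-plane. Harnack's inequality bounds its real part at
the centre by \<open>2 R / r\<close> times that at \<open>b\<close>, and the Schwarz lemma then bounds its derivative at the centre;
the radius \<open>R\<close> cancels, so the estimate is uniform over arbitrarily large discs.
\<close>

lemma log_deriv_bound:
  fixes h :: "complex \<Rightarrow> complex"
  assumes hol: "h holomorphic_on ball a R"
    and unit: "\<And>z. z \<in> ball a R \<Longrightarrow> 0 < norm (h z) \<and> norm (h z) < 1"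
    and r: "0 < r" "dist a b \<le> R - r" and d: "0 < d" "d \<le> norm (h b)"
  shows "norm (deriv h a) \<le> 4 * ln (1 / d) / r * norm (h a)"
proof -
  have R: "R > 0" using r by (smt (verit) zero_le_dist)
  have b: "b \<in> ball a R" using r by simp
  obtain l where l: "l holomorphic_on ball a R" "\<And>z. z \<in> ball a R \<Longrightarrow> h z = exp (l z)"
    using simply_connected_imp_holomorphic_log[OF hol]
    by (metis convex_ball convex_imp_simply_connected convex_imp_locally_path_connected unit zero_less_norm_iff)
  define k where "k z = - l z" for z
  have holk: "k holomorphic_on ball a R" unfolding k_def by (intro holomorphic_intros l)
  have Rek: "Re (k z) = - ln (norm (h z))" if "z \<in> ball a R" for z
    using l(2)[OF that] by (simp add: k_def)
  have posk: "Re (k z) > 0" if "z \<in> ball a R" for z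
    using Rek[OF that] unit[OF that] by simp
  note S = half_plane_Schwarz[OF holk R posk]
  have "Re (k a) * r \<le> Re (k a) * (R - dist a b)"
    using r posk[of a] R by (intro mult_left_mono) auto
  also have "\<dots> \<le> Re (k b) * (R + dist a b)" by (rule S(2)[OF _ b]) 
  also have "\<dots> \<le> ln (1 / d) * (2 * R)"
  proof (rule mult_mono)
    show "Re (k b) \<le> ln (1 / d)" using Rek[OF b] d unit[OF b] by (simp add: ln_div ln_mono)
    then show "0 \<le> ln (1 / d)" using posk[OF b] by linarith
  qed (use r R in auto)
  finally have 1: "Re (k a) * r \<le> ln (1 / d) * (2 * R)" .
  have "norm (deriv k a) * r * R \<le> 2 * (Re (k a) * r)"
    using mult_right_mono[OF S(1), of r] r by (simp add: mult_ac)
  also have "\<dots> \<le> 4 * ln (1 / d) * R" using 1 by (simp add: mult_ac)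
  finally have 2: "norm (deriv k a) \<le> 4 * ln (1 / d) / r"
    using R r by (simp add: field_simps)
  have aR: "a \<in> ball a R" using R by simp
  have "(k has_field_derivative deriv k a) (at a)" by (rule holomorphic_derivI[OF holk _ aR]) simp
  moreover have ha: "h a = exp (- k a)" using l(2)[OF aR] by (simp add: k_def)
  ultimately have "((\<lambda>z. exp (- k z)) has_field_derivative - deriv k a * h a) (at a)"
    by (auto intro!: derivative_eq_intros simp: ha)
  then have "(h has_field_derivative - deriv k a * h a) (at a)"
    by (rule has_field_derivative_transform_within_open[of _ _ _ "ball a R"])
       (use aR l in \<open>auto simp: k_def\<close>)
  then have "deriv h a = - deriv k a * h a" by (rule DERIV_imp_deriv)
  then show ?thesis using mult_right_mono[OF 2 norm_ge_zero[of "h a"]] by (simp add: norm_mult)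
qed

text \<open>
At a common zero \<open>a\<close> both difference quotients \<open>(N z - N a) / (z - a)\<close> and \<open>(D z - D a) / (z - a)\<close> extend
holomorphically, and the second one is nonzero at \<open>a\<close>.
\<close>

lemma entire_quotient_simple_zeros:
  fixes N D :: "complex \<Rightarrow> complex"
  assumes N: "N holomorphic_on UNIV" and D: "D holomorphic_on UNIV"
    and z: "\<And>z. D z = 0 \<Longrightarrow> N z = 0 \<and> deriv D z \<noteq> 0"
  obtains W where "W holomorphic_on UNIV" "\<And>z. N z = W z * D z"
proof -
  define W where "W z = (if D z = 0 then deriv N z / deriv D z else N z / D z)" for z
  have "W field_differentiable at a" for a
  proof (cases "D a = 0")
    case False
    have "continuous (at a) D"
      using D holomorphic_on_imp_continuous_on continuous_on_eq_continuous_at by blast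
    then obtain e where e: "e > 0" "\<And>y. dist a y < e \<Longrightarrow> D y \<noteq> 0"
      using continuous_at_avoid[of a D 0] False by auto
    have "(\<lambda>z. N z / D z) field_differentiable at a"
      using N D False by (intro field_differentiable_divide) (auto simp: holomorphic_on_def)
    then show ?thesis
      by (rule field_differentiable_transform_within[OF e(1), rotated 2])
         (auto simp: W_def e(2) dist_commute)
  next
    case True
    define m where "m z = (if z = a then deriv N a else (N z - N a) / (z - a))" for z
    define d where "d z = (if z = a then deriv D a else (D z - D a) / (z - a))" for z
    have m: "m holomorphic_on UNIV" and d: "d holomorphic_on UNIV"
      unfolding m_def d_def using pole_lemma[OF N, of a] pole_lemma[OF D, of a] by auto
    have da: "d a \<noteq> 0" using z[OF True] by (simp add: d_def)
    have "continuous (at a) d"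
      using d holomorphic_on_imp_continuous_on continuous_on_eq_continuous_at by blast
    then obtain e where e: "e > 0" "\<And>y. dist a y < e \<Longrightarrow> d y \<noteq> 0"
      using continuous_at_avoid[of a d 0] da by auto
    have "(\<lambda>z. m z / d z) field_differentiable at a"
      using m d da by (intro field_differentiable_divide) (auto simp: holomorphic_on_def)
    then show ?thesis
    proof (rule field_differentiable_transform_within[OF e(1), rotated 2])
      fix x assume "dist x a < e"
      then have "d x \<noteq> 0" using e(2) by (simp add: dist_commute)
      then show "m x / d x = W x"
        using True z[OF True] by (cases "x = a") (auto simp: W_def m_def d_def divide_simps)
    qed simp
  qed
  then have "W holomorphic_on UNIV" by (simp add: holomorphic_on_def field_differentiable_at_within)
  moreover have "N z = W z * D z" for z using z[of z] by (auto simp: W_def)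
  ultimately show ?thesis using that by blast
qed

text \<open>
The choice of base points for rescaling. Since \<open>M\<close> need not attain a maximum, \<open>M w (R - \<bar>w - z0\<bar>)\<close> is
maximised over a closed disc instead; a maximiser \<open>z\<close> is so far from the boundary, measured in units of
\<open>1 / M z\<close>, that \<open>M\<close> at most doubles on the disc of radius \<open>k / M z\<close> around it.
\<close>

lemma almost_maximum_on_own_scale:
  fixes M :: "complex \<Rightarrow> real"
  assumes cont: "continuous_on UNIV M" and "M z0 > 0" "k > 0"
  obtains z where "M z \<ge> M z0" "\<And>w. dist z w \<le> k / M z \<Longrightarrow> M w \<le> 2 * M z"
proof -
  define R where "R = 2 * k / M z0"
  have R: "R > 0" using assms by (simp add: R_def)
  have "\<exists>z\<in>cball z0 R. \<forall>w\<in>cball z0 R. M w * (R - dist w z0) \<le> M z * (R - dist z z0)"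
    by (rule continuous_attains_sup)
       (use R in \<open>auto intro!: continuous_intros continuous_on_subset[OF cont]\<close>)
  then obtain z where z: "z \<in> cball z0 R"
    and max: "\<And>w. w \<in> cball z0 R \<Longrightarrow> M w * (R - dist w z0) \<le> M z * (R - dist z z0)" by blast
  define d where "d = R - dist z z0"
  have big: "2 * k \<le> M z * d"
    using max[of z0] R \<open>M z0 > 0\<close> by (simp add: d_def R_def)
  have d0: "0 \<le> d" "d \<le> R" using z by (auto simp: d_def dist_commute)
  then have d: "0 < d" using big \<open>k > 0\<close> by (cases "d = 0") auto
  have Mz: "M z > 0" using big d \<open>k > 0\<close> by (smt (verit) mult_nonpos_nonneg)
  have "M z0 * R \<le> M z * d" using big \<open>M z0 > 0\<close> by (simp add: R_def)
  also have "\<dots> \<le> M z * R" using d0 Mz by (intro mult_left_mono) auto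
  finally have "M z0 \<le> M z" using R by simp
  moreover have "M w \<le> 2 * M z" if "dist z w \<le> k / M z" for w
  proof -
    have "k / M z \<le> d / 2" using big Mz by (simp add: field_simps)
    then have w: "dist z w \<le> d / 2" using that by linarith
    have t: "d / 2 \<le> R - dist w z0"
      using w dist_triangle[of w z0 z] by (simp add: d_def dist_commute)
    have wb: "w \<in> cball z0 R" using t d by (simp add: dist_commute)
    show ?thesis
    proof (cases "M w \<le> 0")
      case False
      then have "M w * (d / 2) \<le> M w * (R - dist w z0)" using t by (intro mult_left_mono) auto
      also have "\<dots> \<le> M z * d" using max[OF wb] by (simp add: d_def)
      finally show ?thesis using d by simp
    qed (use Mz in linarith)
  qed
  ultimately show ?thesis using that by blast
qed

section \<open>A weight that grows like \<open>\<bar>w\<bar> log \<bar>w\<bar>\<close>\<close>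

text \<open>
The metric \<open>\<bar>dw\<bar> / weight w\<close> is complete at infinity: \<open>loglog\<close> is a Lipschitz function for it that tends to
infinity. Near infinity it is comparable with the hyperbolic metric of a punctured disc around that point.
The square of the norm makes \<open>loglog\<close> smooth also at 0.
\<close>

definition loglog :: "complex \<Rightarrow> real" where
  "loglog w = ln (1 + ln (1 + (norm w)\<^sup>2))"

definition weight :: "complex \<Rightarrow> real" where
  "weight w = (1 + norm w) * (1 + ln (1 + (norm w)\<^sup>2))"

lemma weight_ge_1: "1 \<le> weight w"
  using mult_mono[of 1 "1 + norm w" 1 "1 + ln (1 + (norm w)\<^sup>2)"] by (simp add: weight_def)

lemma weight_mono: "norm v \<le> norm w \<Longrightarrow> weight v \<le> weight w"
  unfolding weight_def
  by (intro mult_mono add_mono ln_mono power_mono) (auto simp: add_pos_nonneg)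

lemma continuous_on_weight [continuous_intros]:
  "continuous_on S f \<Longrightarrow> continuous_on S (\<lambda>x. weight (f x))"
  unfolding weight_def
  by (intro continuous_intros) (auto simp: add_nonneg_eq_0_iff)

lemma loglog_mono:
  assumes "norm v \<le> norm w"
  shows "loglog v \<le> loglog w"
proof -
  have "1 + ln (1 + (norm v)\<^sup>2) \<le> 1 + ln (1 + (norm w)\<^sup>2)"
    using assms by (simp add: add_pos_nonneg power_mono)
  moreover have "0 \<le> ln (1 + (norm v)\<^sup>2)" by simp
  ultimately show ?thesis unfolding loglog_def by (intro ln_mono) linarith+
qed

lemma norm_le_exp_exp_loglog: "norm w \<le> exp (exp (loglog w))"
proof -
  have "0 \<le> ln (1 + (norm w)\<^sup>2)" by simp
  then have "0 < 1 + ln (1 + (norm w)\<^sup>2)" by linarith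
  then have "exp (loglog w) = 1 + ln (1 + (norm w)\<^sup>2)" by (simp add: loglog_def)
  then have "exp (exp (loglog w)) = exp 1 * (1 + (norm w)\<^sup>2)"
    by (simp add: exp_add add_pos_nonneg)
  also have "\<dots> \<ge> 1 * (1 + (norm w)\<^sup>2)" by (intro mult_right_mono) auto
  finally show ?thesis
    using sum_squares_bound[of "norm w" 1] by (simp add: power2_eq_square) (smt (verit) zero_le_mult_iff)
qed

text \<open>
A bound on \<open>\<bar>h'\<bar> / weight h\<close> thus controls how fast \<open>\<bar>h\<bar>\<close> can grow, and how fast large values can decrease,
along a segment.
\<close>

lemma loglog_Lipschitz:
  fixes h :: "complex \<Rightarrow> complex"
  assumes hol: "h holomorphic_on S" and S: "open S" "convex S"
    and le: "\<And>z. z \<in> S \<Longrightarrow> norm (deriv h z) \<le> L * weight (h z)"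
    and xy: "x \<in> S" "y \<in> S"
  shows "\<bar>loglog (h x) - loglog (h y)\<bar> \<le> 3 * L * dist x y"
proof -
  define d where "d z v = 2 * (h z \<bullet> (deriv h z * v)) / ((1 + h z \<bullet> h z) * (1 + ln (1 + h z \<bullet> h z)))" for z v
  have L: "0 \<le> L" using le[OF xy(1)] weight_ge_1[of "h x"]
    by (smt (verit) norm_ge_zero mult_nonpos_nonneg mult_neg_pos)
  have der: "((\<lambda>z. loglog (h z)) has_derivative d z) (at z within S)" if z: "z \<in> S" for z
  proof -
    have "(h has_derivative (\<lambda>v. deriv h z * v)) (at z)"
      using holomorphic_derivI[OF hol S(1) z] by (simp add: has_field_derivative_def)
    then have h: "(h has_derivative (\<lambda>v. deriv h z * v)) (at z within S)"
      by (rule has_derivative_at_withinI)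
    have p: "0 < 1 + h z \<bullet> h z" "0 < 1 + ln (1 + h z \<bullet> h z)" by (auto simp: add_pos_nonneg)
    have "((\<lambda>z. ln (1 + ln (1 + h z \<bullet> h z))) has_derivative d z) (at z within S)"
      unfolding d_def using p
      by (auto intro!: derivative_eq_intros h simp: inner_commute divide_simps)
    then show ?thesis by (simp add: loglog_def power2_norm_eq_inner)
  qed
  have "norm (loglog (h x) - loglog (h y)) \<le> (3 * L) * norm (x - y)"
  proof (rule differentiable_bound[OF S(2) der _ xy])
    fix z assume z: "z \<in> S"
    define t where "t = norm (h z)"
    show "onorm (d z) \<le> 3 * L"
    proof (rule onorm_bound)
      show "norm (d z v) \<le> 3 * L * norm v" for v
      proof -
        define a where "a = 1 + t\<^sup>2"
        define b where "b = 1 + ln a"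
        have a: "a > 0" "b > 0" by (auto simp: a_def b_def add_pos_nonneg)
        have t: "t \<ge> 0" by (simp add: t_def)
        have "\<bar>h z \<bullet> (deriv h z * v)\<bar> \<le> t * (norm (deriv h z) * norm v)"
          using Cauchy_Schwarz_ineq2[of "h z" "deriv h z * v"] by (simp add: t_def norm_mult)
        also have "\<dots> \<le> t * ((L * ((1 + t) * b)) * norm v)"
          using le[OF z] t
          by (intro mult_left_mono mult_right_mono) (auto simp: weight_def a_def b_def t_def)
        finally have 1: "\<bar>h z \<bullet> (deriv h z * v)\<bar> \<le> t * ((L * ((1 + t) * b)) * norm v)" .
        have "2 * t * (1 + t) \<le> 3 * a"
          using sum_squares_bound[of t 1] by (simp add: a_def power2_eq_square algebra_simps)
        then have 2: "(2 * t * (1 + t)) * (L * b * norm v) \<le> (3 * a) * (L * b * norm v)"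
          using L a by (intro mult_right_mono) auto
        have "2 * \<bar>h z \<bullet> (deriv h z * v)\<bar> \<le> (2 * t * (1 + t)) * (L * b * norm v)"
          using mult_left_mono[OF 1, of 2] by (simp add: algebra_simps)
        also have "\<dots> \<le> (3 * a) * (L * b * norm v)" by (rule 2)
        finally have 3: "2 * \<bar>h z \<bullet> (deriv h z * v)\<bar> \<le> (3 * L * norm v) * (a * b)"
          by (simp add: mult_ac)
        have "norm (d z v) = 2 * \<bar>h z \<bullet> (deriv h z * v)\<bar> / (a * b)"
          using a by (simp add: d_def a_def b_def t_def power2_norm_eq_inner abs_mult)
        also have "\<dots> \<le> 3 * L * norm v"
          using 3 a by (simp add: pos_divide_le_eq)
        finally show ?thesis .
      qed
    qed (use L in auto)
  qed
  then show ?thesis by (simp add: dist_norm)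
qed

text \<open>
The estimate \<open>log_deriv_bound\<close> for the reciprocal of \<open>h\<close>.
\<close>

lemma log_deriv_bound_outside_disc:
  fixes h :: "complex \<Rightarrow> complex"
  assumes hol: "h holomorphic_on ball a R" and big: "\<And>z. z \<in> ball a R \<Longrightarrow> norm (h z) > 1"
    and r: "0 < r" "dist a b \<le> R - r" and d: "norm (h b) \<le> d"
  shows "norm (deriv h a) \<le> 4 * ln d / r * norm (h a)"
proof -
  have nz: "h z \<noteq> 0" if "z \<in> ball a R" for z using big[OF that] by auto
  have R: "R > 0" using r by (smt (verit) zero_le_dist)
  then have a: "a \<in> ball a R" by simp
  have b: "b \<in> ball a R" using r by simp
  have d1: "1 < d" using big[OF b] d by linarith
  have "norm (deriv (\<lambda>z. inverse (h z)) a) \<le> 4 * ln (1 / (1 / d)) / r * norm (inverse (h a))"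
  proof (rule log_deriv_bound[where b = b, OF _ _ r])
    show "(\<lambda>z. inverse (h z)) holomorphic_on ball a R" using nz by (intro holomorphic_intros hol) auto
    show "0 < cmod (inverse (h z)) \<and> cmod (inverse (h z)) < 1" if "z \<in> ball a R" for z
      using big[OF that] nz[OF that] by (simp add: norm_inverse inverse_less_1_iff)
    show "1 / d \<le> norm (inverse (h b))"
      using d d1 nz[OF b] unfolding norm_inverse by (simp add: divide_simps)
  qed (use d1 in auto)
  moreover have "((\<lambda>z. inverse (h z)) has_field_derivative - (inverse (h a) * deriv h a * inverse (h a))) (at a)"
    by (rule DERIV_inverse'[OF holomorphic_derivI[OF hol _ a] nz[OF a]]) simp
  then have "norm (deriv (\<lambda>z. inverse (h z)) a) = norm (deriv h a) / (norm (h a))\<^sup>2"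
    by (simp add: DERIV_imp_deriv norm_mult norm_inverse divide_inverse power2_eq_square mult_ac)
  ultimately have "norm (deriv h a) / (norm (h a))\<^sup>2 \<le> 4 * ln (1 / (1 / d)) / r * inverse (norm (h a))"
    unfolding norm_inverse by metis
  then have "norm (deriv h a) / (norm (h a))\<^sup>2 \<le> 4 * ln d / r * inverse (norm (h a))" by simp
  then have "norm (deriv h a) / (norm (h a))\<^sup>2 * (norm (h a))\<^sup>2
      \<le> 4 * ln d / r * inverse (norm (h a)) * (norm (h a))\<^sup>2"
    by (rule mult_right_mono) simp
  then show ?thesis using nz[OF a] by (simp add: power2_eq_square field_simps)
qed

text \<open>
A rescaled function whose derivative at the base point equals the weight must therefore come close to the unit
disc within bounded distance. This keeps the rescaled functions from escaping to infinity.
\<close>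

lemma derivative_less_than_weight_outside_disc:
  fixes h :: "complex \<Rightarrow> complex"
  assumes hol: "h holomorphic_on ball a 2" and big: "\<And>z. z \<in> ball a 2 \<Longrightarrow> norm (h z) > 1"
  shows "norm (deriv h a) < weight (h a)"
proof -
  have nz: "h a \<noteq> 0" using big[of a] by auto
  have "norm (deriv h a) \<le> 4 * ln (norm (h a)) / 2 * norm (h a)"
    by (rule log_deriv_bound_outside_disc[OF hol big, where b = a]) auto
  also have "4 * ln (norm (h a)) / 2 = ln ((norm (h a))\<^sup>2)"
    using nz by (simp add: ln_realpow)
  also have "\<dots> \<le> ln (1 + (norm (h a))\<^sup>2)"
    using nz by (intro ln_mono) auto
  also have "ln (1 + (norm (h a))\<^sup>2) * norm (h a) < weight (h a)"
    unfolding weight_def by (simp add: algebra_simps add_pos_nonneg)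
  finally show ?thesis by (simp add: mult_right_mono)
qed

section \<open>Rescaling\<close>

text \<open>
Rescaling in the manner of Zalcman's lemma, with the weight in place of the spherical metric. Around almost maximal points of
\<open>\<bar>g'\<bar> / weight g\<close> the rescaled functions have derivative at most twice their weight on growing discs and
equal to their weight at 0. The Lipschitz bound for \<open>loglog\<close> makes them locally bounded,
so Montel's theorem applies, and the limit has a nonzero derivative at 0 because the weight is at least 1.
\<close>

lemma rescaling_limit:
  fixes g :: "complex \<Rightarrow> complex"
  assumes hol: "g holomorphic_on UNIV"
    and unb: "\<nexists>K. \<forall>z. norm (deriv g z) \<le> K * weight (g z)"
  obtains c :: "nat \<Rightarrow> complex" and \<mu> :: "nat \<Rightarrow> real" and G where
    "\<And>k. \<mu> k \<ge> real k + 1" "G holomorphic_on UNIV" "deriv G 0 \<noteq> 0"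
    "\<And>K. compact K \<Longrightarrow> uniform_limit K (\<lambda>k \<zeta>. g (c k + \<zeta> / of_real (\<mu> k))) G sequentially"
proof -
  define M where "M z = norm (deriv g z) / weight (g z)" for z
  have w0: "0 < weight v" for v using weight_ge_1[of v] by linarith
  have w_nz: "weight v \<noteq> 0" for v using w0[of v] by simp
  have cont: "continuous_on UNIV M"
    unfolding M_def using w_nz
    by (intro continuous_intros holomorphic_on_imp_continuous_on holomorphic_deriv hol) auto
  have "\<exists>c. M c \<ge> real k + 1 \<and> (\<forall>w. dist c w \<le> (real k + 1) / M c \<longrightarrow> M w \<le> 2 * M c)" for k
  proof -
    obtain z0 where "\<not> norm (deriv g z0) \<le> (real k + 1) * weight (g z0)" using unb by blast
    then have z0: "M z0 > real k + 1" using w0[of "g z0"] by (simp add: M_def field_simps)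
    then have "M z0 > 0" by linarith
    then show ?thesis
      using almost_maximum_on_own_scale[OF cont, of z0 "real k + 1"] z0
      by (metis add_nonneg_pos less_eq_real_def less_le_trans of_nat_0_le_iff zero_less_one)
  qed
  then obtain c where c: "\<And>k. M (c k) \<ge> real k + 1"
    "\<And>k w. dist (c k) w \<le> (real k + 1) / M (c k) \<Longrightarrow> M w \<le> 2 * M (c k)" by metis
  define \<mu> where "\<mu> k = M (c k)" for k
  define G where "G k \<zeta> = g (c k + \<zeta> / of_real (\<mu> k))" for k \<zeta>
  have \<mu>: "\<mu> k \<ge> real k + 1" "\<mu> k > 0" for k using c(1)[of k] by (auto simp: \<mu>_def)
  have dG: "(G k has_field_derivative deriv g (c k + \<zeta> / of_real (\<mu> k)) / of_real (\<mu> k)) (at \<zeta>)" for k \<zeta>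
  proof -
    have "((\<lambda>\<zeta>. c k + \<zeta> / of_real (\<mu> k)) has_field_derivative 1 / of_real (\<mu> k)) (at \<zeta>)"
      using \<mu>(2)[of k] by (auto intro!: derivative_eq_intros)
    from DERIV_chain2[OF holomorphic_derivI[OF hol open_UNIV UNIV_I] this]
    show ?thesis unfolding G_def by simp
  qed
  have holG: "G k holomorphic_on S" for k S
    using dG by (meson DERIV_subset holomorphic_on_open holomorphic_on_subset open_UNIV subset_UNIV)
  have derivG: "deriv (G k) \<zeta> = deriv g (c k + \<zeta> / of_real (\<mu> k)) / of_real (\<mu> k)" for k \<zeta>
    using dG by (rule DERIV_imp_deriv)
  have norm_derivG: "norm (deriv (G k) \<zeta>) = M (c k + \<zeta> / of_real (\<mu> k)) / \<mu> k * weight (G k \<zeta>)" for k \<zeta>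
    using w_nz \<mu>(2)[of k] by (simp add: derivG M_def G_def norm_divide)
  have at0: "norm (deriv (G k) 0) = weight (G k 0)" for k
    using \<mu>(2)[of k] by (simp add: norm_derivG \<mu>_def)
  have near: "norm (deriv (G k) \<zeta>) \<le> 2 * weight (G k \<zeta>)" if "norm \<zeta> \<le> real k + 1" for k \<zeta>
  proof -
    have "M (c k + \<zeta> / of_real (\<mu> k)) \<le> 2 * M (c k)"
      by (rule c(2)) (use that \<mu>(2)[of k] in \<open>simp add: \<mu>_def dist_norm norm_divide divide_right_mono\<close>)
    then have "M (c k + \<zeta> / of_real (\<mu> k)) / \<mu> k \<le> 2"
      using \<mu>(2)[of k] by (simp add: \<mu>_def field_simps)
    then show ?thesis unfolding norm_derivG using w0[of "G k \<zeta>"] by (intro mult_right_mono) auto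
  qed
  have lip: "\<bar>loglog (G k x) - loglog (G k y)\<bar> \<le> 6 * dist x y"
    if "norm x < real k + 1" "norm y < real k + 1" for k x y
    using loglog_Lipschitz[OF holG[of k "ball 0 (real k + 1)"] open_ball convex_ball, of 2 x y]
      near[of _ k] that by simp
  \<comment> \<open>\<open>G k\<close> has a value in the unit disc at distance less than 2 from 0, and \<open>loglog\<close> changes by at most 6 per unit of length\<close>
  have start: "loglog (G k 0) \<le> loglog 1 + 12" if "k \<ge> 1" for k
  proof -
    obtain \<zeta> where \<zeta>: "\<zeta> \<in> ball 0 2" "norm (G k \<zeta>) \<le> 1"
      using derivative_less_than_weight_outside_disc[OF holG[of k "ball 0 2"]] at0[of k]
      by (metis less_irrefl not_le)
    have "loglog (G k 0) \<le> loglog (G k \<zeta>) + 6 * dist 0 \<zeta>"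
      using lip[where k=k and x=0 and y=\<zeta>] \<zeta> that by force
    also have "\<dots> \<le> loglog 1 + 6 * 2"
      using \<zeta> by (intro add_mono mult_left_mono loglog_mono) auto
    finally show ?thesis by simp
  qed
  define B where "B R = exp (exp (loglog 1 + 12 + 6 * R))" for R :: real
  have bnd: "norm (G k \<zeta>) \<le> B R" if "k \<ge> 1" "norm \<zeta> < real k + 1" "norm \<zeta> \<le> R" for k \<zeta> R
  proof -
    have "loglog (G k \<zeta>) \<le> loglog 1 + 12 + 6 * R"
      using lip[where k=k and x=\<zeta> and y=0] start[OF that(1)] that by force
    then show ?thesis using norm_le_exp_exp_loglog[of "G k \<zeta>"] by (smt (verit) B_def exp_le_cancel_iff)
  qed
  obtain H r where H: "H holomorphic_on UNIV" "strict_mono (r :: nat \<Rightarrow> nat)"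
    "\<And>K. compact K \<Longrightarrow> uniform_limit K (G \<circ> r) H sequentially"
  proof (rule Montel[of UNIV "range G" G])
    fix K :: "complex set" assume K: "compact K"
    obtain R where R: "\<And>x. x \<in> K \<Longrightarrow> norm x \<le> R" "R > 0"
      using compact_imp_bounded[OF K] by (metis bounded_pos)
    obtain N where N: "N \<ge> 1" "real N > R" by (metis reals_Archimedean2 less_trans linorder_not_less of_nat_1 max.strict_coboundedI1 nle_le of_nat_mono order_le_less_trans)
    have "\<exists>B. \<forall>z\<in>K. norm (G k z) \<le> B" for k
      using compact_continuous_image[OF holomorphic_on_imp_continuous_on[OF holG[of k K]] K]
      by (meson bounded_iff compact_imp_bounded image_eqI)
    then obtain b where b: "\<And>k z. z \<in> K \<Longrightarrow> norm (G k z) \<le> b k" by metis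
    have "norm (G k z) \<le> max (B R) (Max (b ` {..N}))" if z: "z \<in> K" for k z
    proof (cases "k \<le> N")
      case True
      then have "b k \<le> Max (b ` {..N})" by simp
      then show ?thesis using b[OF z, of k] by linarith
    next
      case False
      then have "norm (G k z) \<le> B R" using R(1)[OF z] N by (intro bnd) auto
      then show ?thesis by linarith
    qed
    then show "\<exists>B. \<forall>h\<in>range G. \<forall>z\<in>K. norm (h z) \<le> B" by blast
  qed (use holG in auto)
  have lim0: "(\<lambda>k. deriv (G (r k)) 0) \<longlonglongrightarrow> deriv H 0"
  proof -
    have "uniform_limit (ball 0 1) (G \<circ> r) H sequentially"
      using H(3)[of "cball 0 1"] by (meson ball_subset_cball compact_cball uniform_limit_on_subset)
    from higher_deriv_complex_uniform_limit[OF this _ _ open_ball, of 0 1]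
    show ?thesis using holG by simp
  qed
  have "1 \<le> norm (deriv H 0)"
    by (rule tendsto_lowerbound[OF tendsto_norm[OF lim0]]) (auto simp: at0 weight_ge_1)
  then have "deriv H 0 \<noteq> 0" by auto
  moreover have "\<mu> (r k) \<ge> real k + 1" for k
    using \<mu>(1)[of "r k"] seq_suble[OF H(2), of k] by (smt (verit) of_nat_mono)
  moreover have "uniform_limit K (\<lambda>k \<zeta>. g (c (r k) + \<zeta> / of_real (\<mu> (r k)))) H sequentially" if "compact K" for K
    using H(3)[OF that] by (simp add: G_def[abs_def] o_def)
  ultimately show ?thesis using H(1) that[of "\<mu> \<circ> r" H "c \<circ> r"] by (simp add: o_def)
qed

text \<open>
On a disc around \<open>a\<close> of radius \<open>t\<close> with \<open>\<bar>B\<bar> t \<le> 1/2\<close>, the mean value inequality shows that the maximum of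
\<open>\<bar>D\<bar>\<close> is at most half of itself.
\<close>

lemma entire_zero_if_derivative_dominated:
  fixes D :: "complex \<Rightarrow> complex"
  assumes hol: "D holomorphic_on UNIV" and s: "s > 0" and D0: "D a = 0"
    and le: "\<And>z. z \<in> cball a s \<Longrightarrow> norm (deriv D z) \<le> B * norm (D z)"
  shows "D z = 0"
proof -
  define t where "t = min s (1 / (2 * (\<bar>B\<bar> + 1)))"
  have t: "t > 0" "t \<le> s" using s by (auto simp: t_def)
  have tB: "\<bar>B\<bar> * t \<le> 1 / 2"
  proof -
    have "\<bar>B\<bar> * t \<le> \<bar>B\<bar> * (1 / (2 * (\<bar>B\<bar> + 1)))" by (intro mult_left_mono) (auto simp: t_def)
    also have "\<dots> \<le> 1 / 2" by (simp add: field_simps)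
    finally show ?thesis .
  qed
  have "\<exists>m\<in>cball a t. \<forall>z\<in>cball a t. norm (D z) \<le> norm (D m)"
    by (rule continuous_attains_sup)
       (use t in \<open>auto intro!: continuous_intros holomorphic_on_imp_continuous_on holomorphic_on_subset[OF hol]\<close>)
  then obtain m where m: "m \<in> cball a t" "\<And>z. z \<in> cball a t \<Longrightarrow> norm (D z) \<le> norm (D m)" by blast
  have "norm (D m - D a) \<le> (\<bar>B\<bar> * norm (D m)) * norm (m - a)"
  proof (rule field_differentiable_bound[of "cball a t" D "deriv D"])
    show "(D has_field_derivative deriv D z) (at z within cball a t)" for z
      using holomorphic_derivI[OF hol open_UNIV UNIV_I] by (rule has_field_derivative_at_within)
    show "norm (deriv D z) \<le> \<bar>B\<bar> * norm (D m)" if "z \<in> cball a t" for z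
    proof -
      have "norm (deriv D z) \<le> B * norm (D z)" using that t by (intro le) auto
      also have "\<dots> \<le> \<bar>B\<bar> * norm (D m)" using m(2)[OF that] by (intro mult_mono) auto
      finally show ?thesis .
    qed
  qed (use m t in auto)
  also have "\<dots> \<le> (\<bar>B\<bar> * norm (D m)) * t"
    using m(1) by (intro mult_left_mono) (auto simp: dist_norm norm_minus_commute)
  also have "\<dots> = (\<bar>B\<bar> * t) * norm (D m)" by simp
  also have "\<dots> \<le> 1 / 2 * norm (D m)" by (intro mult_right_mono tB) auto
  finally have "D m = 0" using D0 by simp
  then have "D z = 0" if "z \<in> ball a t" for z using m(2)[of z] that by auto
  then show ?thesis
    using analytic_continuation_open[of "ball a t" UNIV D "\<lambda>_. 0" z] hol t by auto
qed

section \<open>Limits of rescaled powers\<close>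

lemma uniform_limit_power_compact:
  fixes F :: "nat \<Rightarrow> complex \<Rightarrow> complex"
  assumes "uniform_limit K F G sequentially" "continuous_on K G" "compact K"
  shows "uniform_limit K (\<lambda>k z. F k z ^ n) (\<lambda>z. G z ^ n) sequentially"
proof (induction n)
  case (Suc n)
  have "bounded ((\<lambda>z. G z ^ m) ` K)" for m
    using assms by (intro compact_imp_bounded compact_continuous_image continuous_intros)
  from uniform_lim_mult[OF assms(1) Suc _ this] this[of 1] show ?case by simp
qed (simp add: uniform_limit_const)

text \<open>
Cauchy's estimate on unit discs around the points of \<open>K\<close>.
\<close>

lemma uniform_limit_deriv_compact:
  fixes F :: "nat \<Rightarrow> complex \<Rightarrow> complex"
  assumes holF: "\<And>k. F k holomorphic_on UNIV" and holH: "H holomorphic_on UNIV"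
    and lim: "\<And>K. compact K \<Longrightarrow> uniform_limit K F H sequentially" and K: "compact K"
  shows "uniform_limit K (\<lambda>k. deriv (F k)) (deriv H) sequentially"
proof (rule uniform_limitI)
  fix e :: real assume e: "e > 0"
  obtain R where R: "\<And>x. x \<in> K \<Longrightarrow> norm x \<le> R"
    using compact_imp_bounded[OF K] by (metis bounded_pos)
  have "\<forall>\<^sub>F k in sequentially. \<forall>x\<in>cball 0 (R + 1). dist (F k x) (H x) < e / 2"
    using uniform_limitD[OF lim[OF compact_cball], of "e / 2"] e by simp
  then show "\<forall>\<^sub>F k in sequentially. \<forall>x\<in>K. dist (deriv (F k) x) (deriv H x) < e"
  proof eventually_elim
    case (elim k)
    show ?case
    proof
      fix x assume x: "x \<in> K"
      have hol: "(\<lambda>z. F k z - H z) holomorphic_on S" for S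
        using holF holH by (intro holomorphic_intros) (auto intro: holomorphic_on_subset)
      have "norm ((deriv ^^ 1) (\<lambda>z. F k z - H z) x) \<le> fact 1 * (e / 2) / 1 ^ 1"
      proof (rule Cauchy_inequality[OF hol])
        fix y assume "norm (x - y) = 1"
        then have "norm y \<le> R + 1"
          using R[OF x] norm_triangle_ineq4[of x "x - y"] by simp
        then show "norm (F k y - H y) \<le> e / 2" using elim by (auto simp: dist_norm less_imp_le)
      qed (use hol in \<open>auto intro: holomorphic_on_imp_continuous_on\<close>)
      moreover have "deriv (\<lambda>z. F k z - H z) x = deriv (F k) x - deriv H x"
        using holF holH by (intro deriv_diff) (auto simp: holomorphic_on_def)
      ultimately show "dist (deriv (F k) x) (deriv H x) < e" using e by (simp add: dist_norm)
    qed
  qed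
qed

text \<open>
The 1-points of \<open>F k\<close> are simple, as the derivative there is \<open>\<rho> k \<noteq> 0\<close>, and they are zeros of
\<open>deriv (F k) - \<rho> k\<close>. So \<open>(deriv (F k) - \<rho> k) / (F k - 1)\<close> is entire, and on a small circle around a 1-point
of \<open>H\<close> it is bounded uniformly in \<open>k\<close>. By the maximum principle the bound holds inside, and in the limit
\<open>\<bar>deriv H\<bar> \<le> B \<bar>H - 1\<bar>\<close> near that point, which is impossible for a zero of \<open>H - 1\<close>. This replaces a count of
zeros: \<open>p\<close> simple 1-points of \<open>F k\<close> merging into one of order \<open>p\<close> would give \<open>deriv H\<close> a zero of order \<open>p\<close>.
\<close>

lemma limit_omits_1:
  fixes F :: "nat \<Rightarrow> complex \<Rightarrow> complex"
  assumes holF: "\<And>k. F k holomorphic_on UNIV" and holH: "H holomorphic_on UNIV"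
    and lim: "\<And>K. compact K \<Longrightarrow> uniform_limit K F H sequentially"
    and \<rho>: "\<rho> \<longlonglongrightarrow> 0" "\<And>k. \<rho> k \<noteq> 0"
    and fwd: "\<And>k z. F k z = 1 \<Longrightarrow> deriv (F k) z = \<rho> k"
    and nc: "\<not> H constant_on UNIV"
  shows "H a \<noteq> 1"
proof
  assume Ha: "H a = 1"
  obtain b where "H b \<noteq> 1" using nc by (auto simp: constant_on_def)
  have holD: "(\<lambda>z. H z - 1) holomorphic_on S" for S
    using holH by (intro holomorphic_intros) (auto intro: holomorphic_on_subset)
  obtain s0 where s0: "s0 > 0" "\<And>z. z \<in> ball a s0 - {a} \<Longrightarrow> H z - 1 \<noteq> 0"
    using isolated_zeros[OF holD open_UNIV connected_UNIV UNIV_I _ UNIV_I, of a b] Ha \<open>H b \<noteq> 1\<close> by auto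
  define s where "s = s0 / 2"
  have s: "s > 0" using s0 by (simp add: s_def)
  have sph: "H z \<noteq> 1" if "z \<in> sphere a s" for z
    using s0(2)[of z] that s0(1) by (auto simp: s_def)
  have conH: "continuous_on S H" and conH': "continuous_on S (deriv H)" for S
    using holH holomorphic_deriv[OF holH open_UNIV]
    by (auto intro!: holomorphic_on_imp_continuous_on intro: holomorphic_on_subset)
  obtain \<delta> where \<delta>: "\<delta> > 0" "\<And>z. z \<in> sphere a s \<Longrightarrow> \<delta> \<le> norm (H z - 1)"
  proof -
    have "\<exists>m\<in>sphere a s. \<forall>z\<in>sphere a s. norm (H m - 1) \<le> norm (H z - 1)"
      by (rule continuous_attains_inf) (use s conH in \<open>auto intro!: continuous_intros\<close>)
    then show ?thesis using sph that by (metis right_minus_eq zero_less_norm_iff)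
  qed
  obtain C where C: "\<And>z. z \<in> sphere a s \<Longrightarrow> norm (deriv H z) \<le> C"
    using compact_imp_bounded[OF compact_continuous_image[OF conH' compact_sphere]]
    by (meson bounded_iff image_eqI)
  define B where "B = (C + 2) / (\<delta> / 2)"
  have ev: "\<forall>\<^sub>F k in sequentially. \<forall>z\<in>cball a s. norm (deriv (F k) z - \<rho> k) \<le> B * norm (F k z - 1)"
  proof -
    have 1: "\<forall>\<^sub>F k in sequentially. \<forall>z\<in>cball a s. dist (F k z) (H z) < \<delta> / 2"
      using uniform_limitD[OF lim[OF compact_cball], of "\<delta> / 2"] \<delta> by simp
    have 2: "\<forall>\<^sub>F k in sequentially. \<forall>z\<in>cball a s. dist (deriv (F k) z) (deriv H z) < 1"
      using uniform_limitD[OF uniform_limit_deriv_compact[OF holF holH lim compact_cball], of 1] by simp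
    have 3: "\<forall>\<^sub>F k in sequentially. norm (\<rho> k) < 1"
      using tendstoD[OF \<rho>(1), of 1] by simp
    from 1 2 3 show ?thesis
    proof eventually_elim
      case (elim k)
      have h1: "(\<lambda>z. deriv (F k) z - \<rho> k) holomorphic_on UNIV"
        by (intro holomorphic_intros holomorphic_deriv holF) auto
      have h2: "(\<lambda>z. F k z - 1) holomorphic_on UNIV" by (intro holomorphic_intros holF)
      have "deriv (\<lambda>z. F k z - 1) z = deriv (F k) z" for z
        using holF[of k] by (subst deriv_diff) (auto simp: holomorphic_on_def)
      then obtain P where P: "P holomorphic_on UNIV" "\<And>z. deriv (F k) z - \<rho> k = P z * (F k z - 1)"
        using entire_quotient_simple_zeros[OF h1 h2] fwd[of k] \<rho>(2)[of k] by (metis eq_iff_diff_eq_0)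
      have PB: "norm (P z) \<le> B" if "z \<in> cball a s" for z
      proof (rule maximum_modulus_frontier[of P "cball a s"])
        fix w assume w: "w \<in> frontier (cball a s)"
        then have w': "w \<in> sphere a s" "w \<in> cball a s" by (auto simp: frontier_cball)
        have "\<delta> \<le> norm (H w - 1)" using \<delta>(2) w' by simp
        moreover have "norm (F k w - H w) < \<delta> / 2" using elim(1) w' by (simp add: dist_norm)
        moreover have "norm (H w - 1) \<le> norm (F k w - 1) + norm (F k w - H w)"
          using norm_triangle_ineq4[of "F k w - 1" "F k w - H w"] by simp
        ultimately have f: "\<delta> / 2 \<le> norm (F k w - 1)" by linarith
        have "norm (deriv (F k) w - deriv H w) < 1" using elim(2) w' by (simp add: dist_norm)
        moreover have "norm (deriv (F k) w) \<le> norm (deriv H w) + norm (deriv (F k) w - deriv H w)"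
          by (metis add.commute diff_add_cancel norm_triangle_ineq)
        ultimately have "norm (deriv (F k) w - \<rho> k) \<le> C + 2"
          using C[OF w'(1)] elim(3) norm_triangle_ineq4[of "deriv (F k) w" "\<rho> k"] by linarith
        then have "norm (P w) * norm (F k w - 1) \<le> C + 2" using P(2) by (metis norm_mult)
        moreover have "norm (P w) * (\<delta> / 2) \<le> norm (P w) * norm (F k w - 1)"
          using f by (intro mult_left_mono) auto
        ultimately show "norm (P w) \<le> B" using \<delta>(1) by (simp add: B_def field_simps)
      qed (use that P(1) in \<open>auto intro: holomorphic_on_subset holomorphic_on_imp_continuous_on\<close>)
      show ?case using PB by (simp add: P(2) norm_mult mult_right_mono)
    qed
  qed
  have le: "norm (deriv H z) \<le> B * norm (H z - 1)" if z: "z \<in> cball a s" for z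
  proof (rule tendsto_le[of sequentially])
    show "(\<lambda>k. B * norm (F k z - 1)) \<longlonglongrightarrow> B * norm (H z - 1)"
      by (intro tendsto_intros tendsto_uniform_limitI[OF lim[OF compact_cball] z])
    have "(\<lambda>k. norm (deriv (F k) z - \<rho> k)) \<longlonglongrightarrow> norm (deriv H z - 0)"
      by (intro tendsto_intros \<rho> tendsto_uniform_limitI[OF uniform_limit_deriv_compact[OF holF holH lim compact_cball] z])
    then show "(\<lambda>k. norm (deriv (F k) z - \<rho> k)) \<longlonglongrightarrow> norm (deriv H z)" by simp
    show "\<forall>\<^sub>F k in sequentially. norm (deriv (F k) z - \<rho> k) \<le> B * norm (F k z - 1)"
      using ev by eventually_elim (use z in blast)
  qed simp
  have "deriv (\<lambda>z. H z - 1) z = deriv H z" for z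
    using holH by (subst deriv_diff) (auto simp: holomorphic_on_def)
  then have "H b - 1 = 0"
    using entire_zero_if_derivative_dominated[OF holD s, of a B b] le Ha by simp
  with \<open>H b \<noteq> 1\<close> show False by simp
qed

text \<open>
Near \<open>a\<close> the values of \<open>F k\<close> eventually stay away from 1, so \<open>deriv (F k) - \<rho> k\<close> has no zeros there, and
Hurwitz's theorem passes this on to its limit \<open>deriv H\<close>.
\<close>

lemma limit_derivative_nonzero:
  fixes F :: "nat \<Rightarrow> complex \<Rightarrow> complex"
  assumes holF: "\<And>k. F k holomorphic_on UNIV" and holH: "H holomorphic_on UNIV"
    and lim: "\<And>K. compact K \<Longrightarrow> uniform_limit K F H sequentially"
    and \<rho>: "\<rho> \<longlonglongrightarrow> 0"
    and bwd: "\<And>k z. deriv (F k) z = \<rho> k \<Longrightarrow> F k z = 1"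
    and nc: "\<not> H constant_on UNIV" and H1: "\<And>z. H z \<noteq> 1"
  shows "deriv H a \<noteq> 0"
proof (cases "deriv H constant_on ball a 1")
  case True
  show ?thesis
  proof
    assume "deriv H a = 0"
    then have "deriv H z = 0" if "z \<in> ball a 1" for z
      using True that by (metis centre_in_ball constant_on_def zero_less_one)
    then have zero: "deriv H z = 0" for z
      using analytic_continuation_open[of "ball a 1" UNIV "deriv H" "\<lambda>_. 0" z]
        holomorphic_deriv[OF holH open_UNIV] by auto
    then have "(H has_field_derivative 0) (at z)" for z
      using holomorphic_derivI[OF holH open_UNIV UNIV_I, of z] by simp
    then have "H constant_on UNIV"
      using has_field_derivative_zero_constant[of UNIV H] by (auto simp: constant_on_def)
    with nc show False by simp
  qed
next
  case False
  have conH: "continuous_on S H" for S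
    using holH by (auto intro!: holomorphic_on_imp_continuous_on intro: holomorphic_on_subset)
  obtain \<delta> where \<delta>: "\<delta> > 0" "\<And>z. z \<in> cball a 1 \<Longrightarrow> \<delta> \<le> norm (H z - 1)"
  proof -
    have "\<exists>m\<in>cball a 1. \<forall>z\<in>cball a 1. norm (H m - 1) \<le> norm (H z - 1)"
      by (rule continuous_attains_inf) (use conH in \<open>auto intro!: continuous_intros\<close>)
    then show ?thesis using H1 that by (metis right_minus_eq zero_less_norm_iff)
  qed
  have "\<forall>\<^sub>F k in sequentially. \<forall>z\<in>cball a 1. dist (F k z) (H z) < \<delta>"
    using uniform_limitD[OF lim[OF compact_cball], of \<delta>] \<delta> by simp
  then obtain N where N: "\<And>k z. k \<ge> N \<Longrightarrow> z \<in> cball a 1 \<Longrightarrow> dist (F k z) (H z) < \<delta>"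
    unfolding eventually_sequentially by blast
  show ?thesis
  proof (rule Hurwitz_no_zeros[of "ball a 1" "\<lambda>k z. deriv (F (k + N)) z - \<rho> (k + N)" "deriv H"])
    show "(\<lambda>z. deriv (F (k + N)) z - \<rho> (k + N)) holomorphic_on ball a 1" for k
      by (intro holomorphic_intros holomorphic_deriv holomorphic_on_subset[OF holF]) auto
    show "deriv H holomorphic_on ball a 1"
      by (intro holomorphic_intros holomorphic_deriv holomorphic_on_subset[OF holH]) auto
    show "uniform_limit K (\<lambda>k z. deriv (F (k + N)) z - \<rho> (k + N)) (deriv H) sequentially" if "compact K" for K
    proof -
      have "uniform_limit K (\<lambda>k z. deriv (F k) z - \<rho> k) (\<lambda>z. deriv H z - 0) sequentially"
        by (intro uniform_limit_minus uniform_limit_deriv_compact[OF holF holH lim that])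
           (use \<rho> in \<open>simp_all add: uniform_limit_iff tendsto_iff\<close>)
      then have "uniform_limit K (\<lambda>k z. deriv (F k) z - \<rho> k) (deriv H) sequentially" by simp
      from filterlim_compose[OF this filterlim_add_const_nat_at_top[of N]] show ?thesis .
    qed
    show "deriv (F (k + N)) z - \<rho> (k + N) \<noteq> 0" if z: "z \<in> ball a 1" for k z
    proof
      assume "deriv (F (k + N)) z - \<rho> (k + N) = 0"
      then have "F (k + N) z = 1" using bwd by simp
      then show False using N[of "k + N" z] \<delta>(2)[of z] z by (simp add: dist_norm norm_minus_commute)
    qed
  qed (use False in auto)
qed

text \<open>
The condition \<open>share\<close> says that \<open>g\<^sup>n\<close> and its derivative take the value 1 at the same points.
\<close>

locale shared_power =
  fixes g :: "complex \<Rightarrow> complex" and n :: nat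
  assumes hol: "g holomorphic_on UNIV" and n_ge_2: "n \<ge> 2"
    and nonconst: "\<not> g constant_on UNIV"
    and share: "\<And>z. g z ^ n = 1 \<longleftrightarrow> of_nat n * g z ^ (n - 1) * deriv g z = 1"
begin

lemma has_deriv: "(g has_field_derivative deriv g z) (at z within S)"
  using holomorphic_derivI[OF hol open_UNIV UNIV_I] by (rule has_field_derivative_at_within)

lemma holomorphic [holomorphic_intros]: "g holomorphic_on S" "deriv g holomorphic_on S"
  using hol holomorphic_deriv[OF hol open_UNIV] by (auto intro: holomorphic_on_subset)

text \<open>
If the bound fails, the \<open>n\<close>-th powers of the rescaled functions share the value 1 with their derivatives divided
by \<open>\<rho> k\<close>, where \<open>\<rho> k\<close> tends to 0. Their limit \<open>H = G\<^sup>n\<close> omits 1 and has no critical points; but a zero of \<open>G\<close>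
would be a critical point of \<open>H\<close>, because \<open>n \<ge> 2\<close>. So \<open>H\<close> omits 0 and 1 and is constant by Picard's theorem.
\<close>

lemma derivative_dominated_by_weight: "\<exists>K. \<forall>z. norm (deriv g z) \<le> K * weight (g z)"
proof (rule ccontr)
  assume "\<nexists>K. \<forall>z. norm (deriv g z) \<le> K * weight (g z)"
  then obtain c :: "nat \<Rightarrow> complex" and \<mu> :: "nat \<Rightarrow> real" and G where
    \<mu>: "\<And>k. \<mu> k \<ge> real k + 1" and G: "G holomorphic_on UNIV" "deriv G 0 \<noteq> 0"
    and lim: "\<And>K. compact K \<Longrightarrow> uniform_limit K (\<lambda>k \<zeta>. g (c k + \<zeta> / of_real (\<mu> k))) G sequentially"
    by (rule rescaling_limit[OF hol]) (rule that)
  define F where "F k \<zeta> = g (c k + \<zeta> / of_real (\<mu> k)) ^ n" for k \<zeta>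
  define H where "H \<zeta> = G \<zeta> ^ n" for \<zeta>
  define \<rho> where "\<rho> k = complex_of_real (1 / \<mu> k)" for k
  have \<mu>0: "\<mu> k > 0" for k using \<mu>[of k] by linarith
  have dF: "(F k has_field_derivative of_nat n * g (c k + \<zeta> / of_real (\<mu> k)) ^ (n - 1)
      * deriv g (c k + \<zeta> / of_real (\<mu> k)) * \<rho> k) (at \<zeta>)" for k \<zeta>
  proof -
    have "((\<lambda>\<zeta>. c k + \<zeta> / of_real (\<mu> k)) has_field_derivative \<rho> k) (at \<zeta>)"
      using \<mu>0[of k] by (auto intro!: derivative_eq_intros simp: \<rho>_def)
    from DERIV_chain2[OF has_deriv this]
    show ?thesis unfolding F_def by (auto intro!: derivative_eq_intros)
  qed
  have \<rho>0: "\<rho> k \<noteq> 0" for k using \<mu>0[of k] by (simp add: \<rho>_def)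
  have shareF: "F k \<zeta> = 1 \<longleftrightarrow> deriv (F k) \<zeta> = \<rho> k" for k \<zeta>
    unfolding DERIV_imp_deriv[OF dF] using share \<rho>0[of k] by (simp add: F_def)
  have holF: "F k holomorphic_on UNIV" for k
    using dF by (auto simp: holomorphic_on_open)
  have holH: "H holomorphic_on UNIV" unfolding H_def by (intro holomorphic_intros G)
  have limF: "uniform_limit K F H sequentially" if "compact K" for K
    unfolding F_def H_def
    by (intro uniform_limit_power_compact lim that holomorphic_on_imp_continuous_on holomorphic_on_subset[OF G(1)]) auto
  have "(\<lambda>k. 1 / \<mu> k) \<longlonglongrightarrow> 0"
  proof (rule tendsto_sandwich[of "\<lambda>_. 0" _ _ "\<lambda>k. 1 / (real k + 1)"])
    show "\<forall>\<^sub>F k in sequentially. 1 / \<mu> k \<le> 1 / (real k + 1)"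
      using \<mu> by (intro always_eventually allI divide_left_mono) (auto intro!: mult_pos_pos \<mu>0)
  qed (use \<mu>0 LIMSEQ_inverse_real_of_nat in \<open>auto simp: less_imp_le inverse_eq_divide add.commute\<close>)
  then have "(\<lambda>k. complex_of_real (1 / \<mu> k)) \<longlonglongrightarrow> complex_of_real 0" by (rule tendsto_of_real)
  then have \<rho>: "\<rho> \<longlonglongrightarrow> 0" by (simp add: \<rho>_def[abs_def])
  have dG: "(G has_field_derivative deriv G \<zeta>) (at \<zeta>)" for \<zeta>
    by (rule holomorphic_derivI[OF G(1)]) auto
  have "(H has_field_derivative of_nat n * G \<zeta> ^ (n - 1) * deriv G \<zeta>) (at \<zeta>)" for \<zeta>
    unfolding H_def by (auto intro!: derivative_eq_intros dG)
  then have dH: "deriv H \<zeta> = of_nat n * G \<zeta> ^ (n - 1) * deriv G \<zeta>" for \<zeta>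
    by (rule DERIV_imp_deriv)
  have nc: "\<not> H constant_on UNIV"
  proof
    assume "H constant_on UNIV"
    then obtain v where v: "H = (\<lambda>_. v)" by (auto simp: constant_on_def)
    then have "deriv H 0 = 0" by simp
    then have "G 0 = 0" using dH[of 0] G(2) n_ge_2 by simp
    then have "v = 0" using v n_ge_2 by (metis H_def not_numeral_le_zero power_eq_0_iff zero_less_iff_neq_zero)
    then have "G = (\<lambda>_. 0)" using v n_ge_2 by (metis H_def power_eq_0_iff)
    then show False using G(2) by simp
  qed
  have H1: "H \<zeta> \<noteq> 1" for \<zeta>
    by (rule limit_omits_1[OF holF holH limF \<rho> \<rho>0 _ nc]) (use shareF in auto)
  have H': "deriv H \<zeta> \<noteq> 0" for \<zeta>
    by (rule limit_derivative_nonzero[OF holF holH limF \<rho> _ nc H1]) (use shareF in auto)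
  have "H \<zeta> \<noteq> 0" for \<zeta>
    using H'[of \<zeta>] n_ge_2 by (auto simp: dH H_def)
  then obtain v where "H = (\<lambda>_. v)" using little_Picard_01[OF holH] H1 by metis
  then show False using nc by (simp add: constant_on_def)
qed

end

section \<open>From the weight to linear bounds\<close>

lemma point_near_end_of_segment:
  fixes a b :: "'a::real_normed_vector"
  assumes "0 < r" "r \<le> dist a b"
  obtains c where "dist a c = dist a b - r" "dist b c = r"
proof -
  define R where "R = dist a b"
  define c where "c = b + (r / R) *\<^sub>R (a - b)"
  have R: "R > 0" "r \<le> R" "norm (a - b) = R" using assms by (auto simp: R_def dist_norm)
  have "a - c = (1 - r / R) *\<^sub>R (a - b)" by (simp add: c_def algebra_simps)
  then have "dist a c = \<bar>1 - r / R\<bar> * R" using R by (simp add: dist_norm)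
  also have "\<bar>1 - r / R\<bar> = 1 - r / R" using R by simp
  also have "(1 - r / R) * R = R - r" using R by (simp add: field_simps)
  finally have "dist a c = dist a b - r" by (simp add: R_def)
  moreover have "dist b c = r" using R assms by (simp add: c_def dist_norm)
  ultimately show ?thesis by (rule that)
qed

lemma closed_level_sets:
  fixes h :: "complex \<Rightarrow> complex"
  assumes "h holomorphic_on UNIV"
  shows "closed {z. norm (h z) \<le> d}" "closed {z. d \<le> norm (h z)}" "closed {z. h z = 0}"
  using holomorphic_on_imp_continuous_on[OF assms]
  by (auto intro!: closed_Collect_le closed_Collect_eq continuous_intros)

text \<open>
Let \<open>w\<close> be the point nearest to \<open>z\<close> at which \<open>D\<close> vanishes or \<open>\<bar>D\<bar>\<close> reaches 1/2. If \<open>w\<close> is farther away than a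
fixed \<open>r\<close>, the derivative bound around \<open>w\<close> makes \<open>D\<close> not too small at distance \<open>r\<close> from \<open>w\<close>, and
\<open>log_deriv_bound\<close> on the disc around \<open>z\<close> through \<open>w\<close> gives the first alternative. If \<open>w\<close> is close, it must be
a zero, since \<open>\<bar>D\<bar>\<close> cannot have dropped from 1/2 to below 1/4. Near this zero \<open>\<bar>D z\<bar>\<close> is at least half the
distance to \<open>w\<close>, and the derivative deviates from 1 by at most a multiple of that distance: the second
alternative.
\<close>

lemma derivative_near_zeros_of_slope_one:
  fixes D :: "complex \<Rightarrow> complex"
  assumes hol: "D holomorphic_on UNIV" and nc: "\<not> D constant_on UNIV"
    and C1: "C1 \<ge> 1"
    and bnd: "\<And>z w. norm (D z) \<le> 1 / 2 \<Longrightarrow> dist z w \<le> 1 \<Longrightarrow> norm (deriv D w) \<le> C1"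
    and one: "\<And>z. D z = 0 \<Longrightarrow> deriv D z = 1"
  obtains C where "C \<ge> 0" "\<And>z. norm (D z) < 1 / 4 \<Longrightarrow>
      norm (deriv D z) \<le> C * norm (D z) \<or> norm (deriv D z - 1) \<le> C * norm (D z)"
proof -
  \<comment> \<open>over a distance \<open>r\<close> from a point with \<open>\<bar>D\<bar> = 1/2\<close> the function changes by at most 1/4, and over the same distance from a zero its derivative changes by at most 1/2\<close>
  define r where "r = 1 / (4 * C1)"
  define C where "C = 4 * ln (2 / r) / r + 4 * C1"
  have r: "0 < r" "r \<le> 1 / 4" using C1 by (auto simp: r_def field_simps)
  have lnr: "0 \<le> ln (2 / r)" using r by (intro ln_ge_zero) (simp add: field_simps)
  have CC: "C \<ge> 4 * ln (2 / r) / r" "C \<ge> 4 * C1" "C \<ge> 0"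
    using C1 lnr r by (auto simp: C_def)
  have dD: "(D has_field_derivative deriv D z) (at z within S)" for z S
    using holomorphic_derivI[OF hol open_UNIV UNIV_I] by (rule has_field_derivative_at_within)
  have holD': "deriv D holomorphic_on S" for S
    using holomorphic_deriv[OF hol open_UNIV] by (rule holomorphic_on_subset) auto
  have dD': "(deriv D has_field_derivative deriv (deriv D) z) (at z within S)" for z S
    using holomorphic_derivI[OF holD' open_UNIV UNIV_I] by (rule has_field_derivative_at_within)
  have far: "norm (D w) \<ge> 1 / 4" if "norm (D z) = 1 / 2" "dist z w \<le> r" for z w
  proof -
    have "norm (D w - D z) \<le> C1 * norm (w - z)"
      by (rule field_differentiable_bound[of "cball z r" D "deriv D"])
         (use that r bnd[of z] dD in \<open>auto intro: dD\<close>)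
    also have "\<dots> \<le> C1 * r" using that C1 by (intro mult_left_mono) (auto simp: dist_norm norm_minus_commute)
    also have "\<dots> = 1 / 4" using C1 by (simp add: r_def)
    finally show ?thesis using that(1) norm_triangle_ineq3[of "D w" "D z"] by linarith
  qed
  have D'': "norm (deriv (deriv D) w) \<le> 2 * C1" if "D z = 0" "dist z w \<le> 1 / 2" for z w
  proof -
    have "norm ((deriv ^^ 1) (deriv D) w) \<le> fact 1 * C1 / (1 / 2) ^ 1"
    proof (rule Cauchy_inequality[OF holD'])
      fix x assume "norm (w - x) = 1 / 2"
      then have "dist z x \<le> 1" using that(2) dist_triangle[of z x w] by (simp add: dist_norm)
      then show "norm (deriv D x) \<le> C1" using bnd[of z x] that by simp
    qed (use holD' in \<open>auto intro: holomorphic_on_imp_continuous_on\<close>)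
    then show ?thesis by simp
  qed
  have D'1: "norm (deriv D w - 1) \<le> 2 * C1 * dist z w" if "D z = 0" "dist z w \<le> 1 / 2" for z w
  proof -
    have "norm (deriv D w - deriv D z) \<le> 2 * C1 * norm (w - z)"
      by (rule field_differentiable_bound[of "cball z (1/2)" "deriv D" "deriv (deriv D)"])
         (use that D'' in \<open>auto intro: dD'\<close>)
    then show ?thesis using one[OF that(1)] by (simp add: dist_norm norm_minus_commute)
  qed
  have near: "norm (D w) \<ge> dist z w / 2" if "D z = 0" "dist z w \<le> r" for z w
  proof -
    have "norm ((D w - w) - (D z - z)) \<le> 1 / 2 * norm (w - z)"
    proof (rule field_differentiable_bound[of "cball z r" "\<lambda>w. D w - w" "\<lambda>w. deriv D w - 1"])
      show "((\<lambda>w. D w - w) has_field_derivative deriv D x - 1) (at x within cball z r)" for x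
        by (intro derivative_intros dD)
      show "norm (deriv D x - 1) \<le> 1 / 2" if "x \<in> cball z r" for x
      proof -
        have "norm (deriv D x - 1) \<le> 2 * C1 * dist z x"
          using D'1[OF \<open>D z = 0\<close>, of x] that r by simp
        also have "\<dots> \<le> 2 * C1 * r" using that C1 by (intro mult_left_mono) auto
        also have "\<dots> = 1 / 2" using C1 by (simp add: r_def)
        finally show ?thesis .
      qed
    qed (use that r in auto)
    then have "norm (D w - (w - z)) \<le> dist z w / 2"
      using that(1) by (simp add: dist_norm norm_minus_commute algebra_simps)
    moreover have "dist z w \<le> norm (D w) + norm (D w - (w - z))"
      using norm_triangle_ineq4[of "D w" "D w - (w - z)"] by (simp add: dist_norm norm_minus_commute)
    ultimately show ?thesis by linarith
  qed
  define E where "E = {z. 1 / 2 \<le> norm (D z)} \<union> {z. D z = 0}"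
  have E: "closed E" unfolding E_def by (intro closed_Un closed_level_sets[OF hol])
  have "E \<noteq> {}"
  proof
    assume "E = {}"
    then have "z \<notin> E" for z by simp
    then have "norm (D z) \<le> 1 / 2" for z unfolding E_def using linear by blast
    then have "bounded (range D)" unfolding bounded_iff by blast
    then show False using Liouville_theorem[OF hol] nc by simp
  qed
  have "norm (deriv D z) \<le> C * norm (D z) \<or> norm (deriv D z - 1) \<le> C * norm (D z)"
    if z: "norm (D z) < 1 / 4" for z
  proof (cases "D z = 0")
    case True
    then show ?thesis using one by simp
  next
    case False
    obtain w where w: "w \<in> E" "\<And>y. y \<in> E \<Longrightarrow> dist z w \<le> dist z y"
      using distance_attains_inf[OF E \<open>E \<noteq> {}\<close>, of z] by blast
    define R where "R = dist z w"
    have R: "R > 0" using w(1) False z by (auto simp: R_def E_def)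
    have ball: "0 < norm (D y) \<and> norm (D y) < 1 / 2" if "y \<in> ball z R" for y
      using w(2)[of y] that by (force simp: R_def E_def)
    have w_le: "norm (D w) \<le> 1 / 2"
    proof (rule continuous_on_closure_norm_le[of "ball z R" D])
      show "continuous_on (closure (ball z R)) D"
        by (intro holomorphic_on_imp_continuous_on holomorphic_on_subset[OF hol]) auto
      show "\<forall>y\<in>ball z R. norm (D y) \<le> 1 / 2" using ball less_imp_le by blast
      show "w \<in> closure (ball z R)" using R by (simp add: R_def)
    qed
    have w_cases: "D w = 0 \<or> norm (D w) = 1 / 2" using w(1) w_le by (auto simp: E_def)
    show ?thesis
    proof (cases "R \<le> r")
      case True
      have Dw: "D w = 0" using w_cases far[of w z] z True by (auto simp: R_def dist_commute)
      have "norm (deriv D z - 1) \<le> 2 * C1 * R"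
        using D'1[OF Dw, of z] True r by (simp add: R_def dist_commute)
      also have "\<dots> \<le> 2 * C1 * (2 * norm (D z))"
        using near[OF Dw, of z] True C1 by (intro mult_left_mono) (auto simp: R_def dist_commute)
      also have "\<dots> \<le> C * norm (D z)" using mult_right_mono[OF CC(2), of "norm (D z)"] by simp
      finally show ?thesis by simp
    next
      case False
      then obtain b where b: "dist z b = R - r" "dist w b = r"
        using point_near_end_of_segment[of r z w] r by (auto simp: R_def)
      have "norm (deriv D z) \<le> 4 * ln (1 / (r / 2)) / r * norm (D z)"
      proof (rule log_deriv_bound[of D z R r b])
        show "D holomorphic_on ball z R" using hol by (rule holomorphic_on_subset) auto
        show "r / 2 \<le> norm (D b)" using w_cases far[of w b] near[of w b] b r by auto
      qed (use ball b r in force)+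
      also have "\<dots> \<le> C * norm (D z)" using CC(1) by (intro mult_right_mono) auto
      finally show ?thesis by simp
    qed
  qed
  then show ?thesis using that[OF CC(3)] by blast
qed

context shared_power
begin

lemma locally_bounded: "\<exists>B\<ge>1. \<forall>z w. norm (g z) \<le> 2 \<longrightarrow> dist z w \<le> 1 \<longrightarrow> norm (g w) \<le> B"
proof -
  obtain K where K: "\<And>z. norm (deriv g z) \<le> K * weight (g z)"
    using derivative_dominated_by_weight by blast
  have "0 \<le> K" using K[of 0] weight_ge_1[of "g 0"]
    by (smt (verit) norm_ge_zero mult_neg_pos)
  define B where "B = exp (exp (loglog 2 + 3 * K))"
  have "norm (g w) \<le> B" if "norm (g z) \<le> 2" "dist z w \<le> 1" for z w
  proof -
    have "loglog (g w) \<le> loglog (g z) + 3 * K * dist w z"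
      using loglog_Lipschitz[OF hol open_UNIV convex_UNIV K UNIV_I UNIV_I, of w z] by linarith
    also have "\<dots> \<le> loglog 2 + 3 * K * 1"
      using that \<open>0 \<le> K\<close> by (intro add_mono mult_left_mono loglog_mono) (auto simp: dist_commute)
    finally have "exp (exp (loglog (g w))) \<le> B" by (simp add: B_def)
    then show ?thesis using norm_le_exp_exp_loglog[of "g w"] by linarith
  qed
  moreover have "B \<ge> 1" by (simp add: B_def)
  ultimately show ?thesis by blast
qed

lemma derivative_bounded_where_bounded: "\<exists>K'. \<forall>z. norm (g z) \<le> B \<longrightarrow> norm (deriv g z) \<le> K'"
proof -
  obtain K where K: "\<And>z. norm (deriv g z) \<le> K * weight (g z)"
    using derivative_dominated_by_weight by blast
  have "0 \<le> K" using K[of 0] weight_ge_1[of "g 0"]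
    by (smt (verit) norm_ge_zero mult_neg_pos)
  have "norm (deriv g z) \<le> K * weight (of_real B)" if "norm (g z) \<le> B" for z
  proof -
    have "K * weight (g z) \<le> K * weight (of_real B)"
      using that \<open>0 \<le> K\<close> by (intro mult_left_mono weight_mono) auto
    then show ?thesis using K[of z] by linarith
  qed
  then show ?thesis by blast
qed

text \<open>
This improves the bound \<open>\<bar>g'\<bar> \<le> K weight g\<close> by a logarithm. Apply \<open>log_deriv_bound_outside_disc\<close> to the
largest disc around \<open>z\<close> on which \<open>\<bar>g\<bar> > 1\<close>: at a point of distance 1 from its boundary point \<open>w\<close> with
\<open>\<bar>g w\<bar> \<le> 1\<close>, the function is bounded by a constant.
\<close>

lemma log_derivative_bounded_outside_disc: "\<exists>C. \<forall>z. 1 \<le> norm (g z) \<longrightarrow> norm (deriv g z) \<le> C * norm (g z)"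
proof -
  obtain B where B: "B \<ge> 1" "\<And>z w. norm (g z) \<le> 2 \<Longrightarrow> dist z w \<le> 1 \<Longrightarrow> norm (g w) \<le> B"
    using locally_bounded by blast
  obtain K where K: "\<And>z. norm (g z) \<le> B \<Longrightarrow> norm (deriv g z) \<le> K"
    using derivative_bounded_where_bounded by blast
  define E where "E = {z. norm (g z) \<le> 1}"
  have E: "closed E" unfolding E_def by (rule closed_level_sets[OF hol])
  have "E \<noteq> {}"
  proof
    assume "E = {}"
    then have "z \<notin> E" for z by simp
    then have gt: "norm (g z) > 1" for z by (simp add: E_def not_le)
    then have nz: "g z \<noteq> 0" for z by (metis norm_zero not_one_less_zero)
    have "norm (inverse (g z)) \<le> 1" for z
      using gt[of z] by (simp add: norm_inverse inverse_le_1_iff)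
    then have "bounded (range (\<lambda>z. inverse (g z)))" by (auto simp: bounded_iff)
    then have "(\<lambda>z. inverse (g z)) constant_on UNIV"
      using nz by (intro Liouville_theorem holomorphic_intros) auto
    then have "g constant_on UNIV" unfolding constant_on_def by (metis inverse_inverse_eq)
    then show False using nonconst by simp
  qed
  have "norm (deriv g z) \<le> max K (4 * ln B) * norm (g z)" if z: "1 \<le> norm (g z)" for z
  proof (cases "norm (g z) \<le> B")
    case True
    have "norm (deriv g z) \<le> max K (4 * ln B) * 1" using K[OF True] by simp
    also have "\<dots> \<le> max K (4 * ln B) * norm (g z)"
      using z B(1) by (intro mult_left_mono) (auto simp: le_max_iff_disj)
    finally show ?thesis .
  next
    case False
    obtain w where w: "w \<in> E" "\<And>y. y \<in> E \<Longrightarrow> dist z w \<le> dist z y"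
      using distance_attains_inf[OF E \<open>E \<noteq> {}\<close>, of z] by blast
    have "1 \<le> dist z w"
      using B(2)[of w z] w(1) False by (force simp: E_def dist_commute)
    then obtain b where b: "dist z b = dist z w - 1" "dist w b = 1"
      using point_near_end_of_segment[of 1 z w] by auto
    have "norm (deriv g z) \<le> 4 * ln B / 1 * norm (g z)"
    proof (rule log_deriv_bound_outside_disc[of g z "dist z w" 1 b])
      show "norm (g y) > 1" if "y \<in> ball z (dist z w)" for y
        using w(2)[of y] that by (force simp: E_def)
      show "norm (g b) \<le> B" using B(2)[of w b] w(1) b by (auto simp: E_def)
    qed (use b in \<open>auto intro: holomorphic_intros\<close>)
    also have "\<dots> \<le> max K (4 * ln B) * norm (g z)" by (intro mult_right_mono) auto
    finally show ?thesis .
  qed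
  then show ?thesis by blast
qed

end

section \<open>The differential equation with constant quotient\<close>

lemma entire_no_zero_divisors:
  fixes A B :: "complex \<Rightarrow> complex"
  assumes "A holomorphic_on UNIV" "B holomorphic_on UNIV" "\<And>z. A z * B z = 0"
  shows "(\<forall>z. A z = 0) \<or> (\<forall>z. B z = 0)"
proof (rule ccontr)
  assume "\<not> ?thesis"
  then obtain a b where a: "A a \<noteq> 0" and b: "B b \<noteq> 0" by blast
  have "continuous (at a) A"
    using assms(1) holomorphic_on_imp_continuous_on continuous_on_eq_continuous_at by blast
  then obtain e where e: "e > 0" "\<And>y. dist a y < e \<Longrightarrow> A y \<noteq> 0"
    using continuous_at_avoid[of a A 0] a by auto
  have "B z = 0" if "z \<in> ball a e" for z using assms(3)[of z] e(2)[of z] that by simp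
  then have "B b = 0"
    using analytic_continuation_open[of "ball a e" UNIV B "\<lambda>_. 0" b] assms(2) e(1) by auto
  with b show False by simp
qed

lemma entire_constant_if_derivative_zero:
  fixes g :: "complex \<Rightarrow> complex"
  assumes "g holomorphic_on UNIV" "\<And>z. deriv g z = 0"
  shows "g constant_on UNIV"
proof -
  have "(g has_field_derivative 0) (at z)" for z
    using holomorphic_derivI[OF assms(1) open_UNIV UNIV_I, of z] assms(2) by simp
  then show ?thesis using has_field_derivative_zero_constant[of UNIV g] by (auto simp: constant_on_def)
qed

context shared_power
begin

lemma power_deriv: "((\<lambda>z. g z ^ n - 1) has_field_derivative of_nat n * g z ^ (n - 1) * deriv g z) (at z)"
  by (auto intro!: derivative_eq_intros has_deriv)

lemma power_nonconst: "\<not> (\<lambda>z. g z ^ n - 1) constant_on UNIV"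
proof
  assume "(\<lambda>z. g z ^ n - 1) constant_on UNIV"
  then obtain c where "\<And>z. g z ^ n - 1 = c" by (auto simp: constant_on_def)
  then have "((\<lambda>_. c) has_field_derivative of_nat n * g z ^ (n - 1) * deriv g z) (at z)" for z
    using power_deriv by simp
  then have "g z ^ (n - 1) * deriv g z = 0" for z
    using DERIV_unique[OF _ DERIV_const] n_ge_2 by fastforce
  then consider "\<And>z. g z ^ (n - 1) = 0" | "\<And>z. deriv g z = 0"
    using entire_no_zero_divisors[of "\<lambda>z. g z ^ (n - 1)" "deriv g"] holomorphic
    by (metis holomorphic_on_power)
  then show False
    using nonconst entire_constant_if_derivative_zero[OF hol]
    by cases (auto simp: constant_on_def)
qed

text \<open>
At a 1-point of \<open>g\<^sup>n\<close> the derivative of \<open>g\<^sup>n\<close> is \<open>1 = g\<^sup>n\<close>, which amounts to \<open>n g' = g\<close>. So the numerator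
vanishes at the zeros of the denominator, and these are simple.
\<close>

lemma entire_ODE_quotient:
  obtains W where "W holomorphic_on UNIV"
    "\<And>z. of_nat n * g z ^ (n - 2) * deriv g z * (of_nat n * deriv g z - g z) = W z * (g z ^ n - 1)"
proof (rule entire_quotient_simple_zeros[of
    "\<lambda>z. of_nat n * g z ^ (n - 2) * deriv g z * (of_nat n * deriv g z - g z)" "\<lambda>z. g z ^ n - 1"])
  fix z assume "g z ^ n - 1 = 0"
  then have 1: "g z ^ n = 1" "of_nat n * g z ^ (n - 1) * deriv g z = 1" using share by auto
  have "g z ^ n = g z ^ (n - 1) * g z" using n_ge_2 by (metis One_nat_def Suc_1 Suc_le_D diff_Suc_1 power_Suc2)
  then have "g z ^ (n - 1) * (of_nat n * deriv g z - g z) = 0" using 1 by (simp add: algebra_simps)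
  moreover have "g z \<noteq> 0" using 1(1) n_ge_2 by (auto simp: power_0_left)
  ultimately show "of_nat n * g z ^ (n - 2) * deriv g z * (of_nat n * deriv g z - g z) = 0
      \<and> deriv (\<lambda>z. g z ^ n - 1) z \<noteq> 0"
    using DERIV_imp_deriv[OF power_deriv] 1 by simp
qed (use that in \<open>auto intro!: holomorphic_intros holomorphic_on_subset[OF hol]\<close>)

text \<open>
With \<open>F = g\<^sup>n\<close> the numerator is \<open>F' (F' - F) / F\<close>; in this form it is estimated where \<open>F\<close> is close to 1.
\<close>

lemma ODE_numerator_times_power:
  "of_nat n * g z ^ (n - 2) * deriv g z * (of_nat n * deriv g z - g z) * g z ^ n =
   (of_nat n * g z ^ (n - 1) * deriv g z) * (of_nat n * g z ^ (n - 1) * deriv g z - g z ^ n)"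
proof -
  obtain m where n: "n = m + 2" using n_ge_2 by (metis add.commute le_Suc_ex)
  show ?thesis unfolding n by (simp add: algebra_simps power_add power2_eq_square)
qed

text \<open>
Where \<open>g\<^sup>n\<close> is at distance at least 1/4 from 1, the bounds on \<open>g'\<close> suffice: the numerator has the order of
\<open>\<bar>g\<bar>\<^sup>n\<close> for \<open>\<bar>g\<bar> \<ge> 1\<close> and is bounded for \<open>\<bar>g\<bar> \<le> 1\<close>. Where \<open>D = g\<^sup>n - 1\<close> is smaller, the numerator is comparable with
\<open>D' (D' - 1 - D)\<close>, one of whose factors is of the order of \<open>D\<close> by \<open>derivative_near_zeros_of_slope_one\<close>.
\<close>

lemma ODE_quotient_bounded:
  "\<exists>C. \<forall>z. norm (of_nat n * g z ^ (n - 2) * deriv g z * (of_nat n * deriv g z - g z))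
       \<le> C * norm (g z ^ n - 1)"
proof -
  define N where "N z = of_nat n * g z ^ (n - 2) * deriv g z * (of_nat n * deriv g z - g z)" for z
  define D where "D z = g z ^ n - 1" for z
  have holD: "D holomorphic_on UNIV" unfolding D_def by (intro holomorphic_intros)
  have D': "deriv D z = of_nat n * g z ^ (n - 1) * deriv g z" for z
    unfolding D_def by (rule DERIV_imp_deriv[OF power_deriv])
  obtain B where B: "B \<ge> 1" "\<And>z w. norm (g z) \<le> 2 \<Longrightarrow> dist z w \<le> 1 \<Longrightarrow> norm (g w) \<le> B"
    using locally_bounded by blast
  obtain K where K: "\<And>z. norm (g z) \<le> B \<Longrightarrow> norm (deriv g z) \<le> K"
    using derivative_bounded_where_bounded by blast
  obtain L0 where L0: "\<And>z. 1 \<le> norm (g z) \<Longrightarrow> norm (deriv g z) \<le> L0 * norm (g z)"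
    using log_derivative_bounded_outside_disc by blast
  define L where "L = max L0 0"
  have "norm (deriv g z) \<le> L * norm (g z)" if "1 \<le> norm (g z)" for z
  proof -
    have "L0 * norm (g z) \<le> L * norm (g z)" by (intro mult_right_mono) (auto simp: L_def)
    then show ?thesis using L0[OF that] by linarith
  qed
  then have L: "L \<ge> 0" "\<And>z. 1 \<le> norm (g z) \<Longrightarrow> norm (deriv g z) \<le> L * norm (g z)"
    by (auto simp: L_def)
  define C1 where "C1 = max 1 (real n * B ^ (n - 1) * K)"
  have small: "norm (g z) \<le> 2" if "norm (D z) \<le> 1 / 2" for z
  proof (rule ccontr)
    assume "\<not> norm (g z) \<le> 2"
    then have "2 \<le> norm (g z) ^ n" using self_le_power[of "norm (g z)" n] n_ge_2 by linarith
    then have "2 \<le> norm (g z ^ n)" by (simp add: norm_power)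
    moreover have "norm (g z ^ n) \<le> norm (D z) + 1"
      using norm_triangle_ineq[of "D z" 1] by (simp add: D_def)
    ultimately show False using that by linarith
  qed
  have D'_bnd: "norm (deriv D w) \<le> C1" if "norm (D z) \<le> 1 / 2" "dist z w \<le> 1" for z w
  proof -
    have w: "norm (g w) \<le> B" using B(2)[OF small] that by blast
    have "norm (deriv D w) = real n * norm (g w) ^ (n - 1) * norm (deriv g w)"
      by (simp add: D' norm_mult norm_power)
    also have "\<dots> \<le> real n * B ^ (n - 1) * K"
      using w K[OF w] B(1) by (intro mult_mono power_mono) auto
    finally show ?thesis by (simp add: C1_def)
  qed
  obtain C where C: "C \<ge> 0" "\<And>z. norm (D z) < 1 / 4 \<Longrightarrow>
      norm (deriv D z) \<le> C * norm (D z) \<or> norm (deriv D z - 1) \<le> C * norm (D z)"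
  proof (rule derivative_near_zeros_of_slope_one[of D C1])
    show "\<not> D constant_on UNIV" using power_nonconst by (simp add: D_def[abs_def])
    show "deriv D z = 1" if "D z = 0" for z using that share[of z] by (simp add: D' D_def)
  qed (use holD D'_bnd that in \<open>auto simp: C1_def\<close>)
  define A1 where "A1 = real n * L * (real n * L + 1) * 5"
  define A2 where "A2 = real n * K * (real n * K + 1) * 4"
  define A3 where "A3 = 2 * (C1 + 2) * (C + 1) * (C1 + 1)"
  have K0: "K \<ge> 0" if "norm (g z) \<le> B" for z using K[OF that] norm_ge_zero order_trans by blast
  have C1: "C1 \<ge> 1" by (simp add: C1_def)
  have "norm (N z) \<le> (A1 + \<bar>A2\<bar> + A3) * norm (D z)" for z
  proof -
    have A: "A1 \<ge> 0" "A3 \<ge> 0" using L(1) C1 C(1) by (auto simp: A1_def A3_def)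
    consider "norm (D z) \<ge> 1 / 4" "norm (g z) \<ge> 1" | "norm (D z) \<ge> 1 / 4" "norm (g z) \<le> 1"
      | "norm (D z) < 1 / 4" by linarith
    then have "norm (N z) \<le> A1 * norm (D z) \<or> norm (N z) \<le> A2 * norm (D z) \<or> norm (N z) \<le> A3 * norm (D z)"
    proof cases
      case 1
      have "norm (N z) \<le> real n * norm (g z) ^ (n - 2) * (L * norm (g z)) * (real n * (L * norm (g z)) + norm (g z))"
        unfolding N_def norm_mult norm_power norm_of_nat
        using L(1) L(2)[OF 1(2)]
        by (intro mult_mono order_trans[OF norm_triangle_ineq4] add_mono) (auto simp: norm_mult mult_left_mono)
      also have "\<dots> = real n * L * (real n * L + 1) * (norm (g z) ^ (n - 2) * (norm (g z))\<^sup>2)"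
        by (simp add: algebra_simps power2_eq_square)
      also have "\<dots> \<le> real n * L * (real n * L + 1) * (5 * norm (D z))"
      proof (rule mult_left_mono)
        have "norm (g z) ^ (n - 2) * (norm (g z))\<^sup>2 = norm (g z ^ n)"
          using power_add[of "norm (g z)" "n - 2" 2] n_ge_2
          by (simp only: norm_power le_add_diff_inverse2)
        also have "norm (g z ^ n) \<le> 5 * norm (D z)"
          using norm_triangle_ineq[of "D z" 1] 1 by (simp add: D_def)
        finally show "norm (g z) ^ (n - 2) * (norm (g z))\<^sup>2 \<le> 5 * norm (D z)" .
      qed (use L(1) in simp)
      also have "\<dots> = A1 * norm (D z)" by (simp add: A1_def)
      finally show ?thesis by simp
    next
      case 2
      have k: "norm (deriv g z) \<le> K" "K \<ge> 0" using K[of z] K0[of z] 2 B(1) by auto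
      have "norm (N z) \<le> real n * 1 * K * (real n * K + 1)"
        unfolding N_def norm_mult norm_power norm_of_nat
        using k 2 by (intro mult_mono order_trans[OF norm_triangle_ineq4] add_mono)
          (auto simp: norm_mult mult_left_mono power_le_one)
      also have "\<dots> = A2 * (1 / 4)" by (simp add: A2_def)
      also have "\<dots> \<le> A2 * norm (D z)" using 2 k by (intro mult_left_mono) (auto simp: A2_def)
      finally show ?thesis by simp
    next
      case 3
      have d: "norm (deriv D z) \<le> C1" using D'_bnd[of z z] 3 by simp
      have gz: "g z ^ n = 1 + D z" by (simp add: D_def)
      have "3 / 4 \<le> norm (g z ^ n)"
        using norm_triangle_ineq4[of "g z ^ n" "D z"] 3 by (simp add: gz)
      then have "norm (N z) * (1 / 2) \<le> norm (N z) * norm (g z ^ n)"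
        by (intro mult_left_mono) auto
      also have "norm (N z) * norm (g z ^ n) = norm (deriv D z) * norm (deriv D z - 1 - D z)"
      proof -
        have "N z * g z ^ n = deriv D z * (deriv D z - g z ^ n)"
          unfolding N_def D' by (rule ODE_numerator_times_power)
        also have "deriv D z - g z ^ n = deriv D z - 1 - D z" by (simp add: gz)
        finally show ?thesis by (metis norm_mult)
      qed
      finally have N: "norm (N z) \<le> 2 * (norm (deriv D z) * norm (deriv D z - 1 - D z))" by simp
      have t: "norm (deriv D z - 1 - D z) \<le> norm (deriv D z) + 1 + norm (D z)"
        "norm (deriv D z - 1 - D z) \<le> norm (deriv D z - 1) + norm (D z)"
        using norm_triangle_ineq4[of "deriv D z - 1" "D z"] norm_triangle_ineq4[of "deriv D z" 1] by auto
      from C(2)[OF 3] have "norm (deriv D z) * norm (deriv D z - 1 - D z) \<le> (C1 + 2) * (C + 1) * (C1 + 1) * norm (D z)"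
      proof
        assume a: "norm (deriv D z) \<le> C * norm (D z)"
        have "norm (deriv D z) * norm (deriv D z - 1 - D z) \<le> (C * norm (D z)) * (C1 + 2)"
          using a t(1) d 3 C(1) by (intro mult_mono) auto
        also have "\<dots> \<le> ((C + 1) * (C1 + 1)) * norm (D z) * (C1 + 2)"
          using C1 C(1) by (intro mult_right_mono) (auto simp: algebra_simps)
        finally show ?thesis by (simp add: mult_ac)
      next
        assume a: "norm (deriv D z - 1) \<le> C * norm (D z)"
        have "norm (deriv D z) * norm (deriv D z - 1 - D z) \<le> C1 * ((C + 1) * norm (D z))"
          using a t(2) d C1 by (intro mult_mono) (auto simp: algebra_simps)
        also have "\<dots> \<le> ((C1 + 2) * (C1 + 1)) * ((C + 1) * norm (D z))"
          using C1 C(1) by (intro mult_right_mono) (auto simp: algebra_simps)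
        finally show ?thesis by (simp add: mult_ac)
      qed
      then have "norm (N z) \<le> 2 * ((C1 + 2) * (C + 1) * (C1 + 1) * norm (D z))" using N by linarith
      also have "\<dots> = A3 * norm (D z)" by (simp only: A3_def mult.assoc)
      finally show ?thesis by simp
    qed
    moreover have "A1 * norm (D z) \<le> (A1 + \<bar>A2\<bar> + A3) * norm (D z)"
      "A2 * norm (D z) \<le> (A1 + \<bar>A2\<bar> + A3) * norm (D z)"
      "A3 * norm (D z) \<le> (A1 + \<bar>A2\<bar> + A3) * norm (D z)"
      using A by (auto intro!: mult_right_mono)
    ultimately show ?thesis by linarith
  qed
  then show ?thesis unfolding N_def D_def by blast
qed

lemma ODE_constant_quotient:
  "\<exists>c. \<forall>z. of_nat n * g z ^ (n - 2) * deriv g z * (of_nat n * deriv g z - g z) = c * (g z ^ n - 1)"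
proof -
  obtain W where W: "W holomorphic_on UNIV"
    "\<And>z. of_nat n * g z ^ (n - 2) * deriv g z * (of_nat n * deriv g z - g z) = W z * (g z ^ n - 1)"
    using entire_ODE_quotient by metis
  obtain C where C: "\<And>z. norm (of_nat n * g z ^ (n - 2) * deriv g z * (of_nat n * deriv g z - g z))
       \<le> C * norm (g z ^ n - 1)"
    using ODE_quotient_bounded by blast
  define D where "D z = g z ^ n - 1" for z
  have holD: "D holomorphic_on UNIV" unfolding D_def by (intro holomorphic_intros)
  have off: "norm (W z) \<le> C" if "D z \<noteq> 0" for z
  proof -
    have "norm (W z) * norm (D z) \<le> C * norm (D z)"
      using C[of z] unfolding W(2) by (simp only: D_def norm_mult)
    then show ?thesis using that by simp
  qed
  have "norm (W z) \<le> C" for z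
  proof (cases "D z = 0")
    case True
    obtain b where "D b \<noteq> 0" using power_nonconst unfolding constant_on_def D_def by blast
    obtain r where r: "r > 0" "\<And>w. w \<in> ball z r - {z} \<Longrightarrow> D w \<noteq> 0"
      by (rule isolated_zeros[OF holD open_UNIV connected_UNIV UNIV_I True UNIV_I \<open>D b \<noteq> 0\<close>])
         (rule that)
    show ?thesis
    proof (rule maximum_modulus_frontier[of W "cball z (r / 2)"])
      show "norm (W w) \<le> C" if "w \<in> frontier (cball z (r / 2))" for w
        using that r by (intro off r(2)) (auto simp: frontier_cball)
    qed (use r W(1) in \<open>auto intro: holomorphic_on_subset holomorphic_on_imp_continuous_on\<close>)
  qed (rule off)
  then have "bounded (range W)" by (auto simp: bounded_iff)
  then obtain c where "\<And>z. W z = c"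
    using Liouville_theorem[OF W(1)] by (auto simp: constant_on_def)
  then show ?thesis using W(2) by metis
qed

end

section \<open>Solutions of the differential equation\<close>

lemma entire_omitting_two_values_constant:
  assumes "f holomorphic_on UNIV" "a \<noteq> b" "\<And>z. f z \<noteq> a" "\<And>z. f z \<noteq> b"
  shows "f constant_on UNIV"
proof -
  obtain c where "f = (\<lambda>_. c)"
    by (rule little_Picard[OF assms(1,2)]) (use assms(3,4) in auto)
  then show ?thesis by (simp add: constant_on_def)
qed

context shared_power
begin

lemma ODE_zero_quotient:
  assumes "\<And>z. of_nat n * g z ^ (n - 2) * deriv g z * (of_nat n * deriv g z - g z) = 0"
  shows "g z = of_nat n * deriv g z"
proof -
  have "(g z ^ (n - 2) * deriv g z) * (of_nat n * deriv g z - g z) = 0" for z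
    using assms[of z] n_ge_2 by auto
  then consider "\<And>z. g z ^ (n - 2) * deriv g z = 0" | "\<And>z. of_nat n * deriv g z - g z = 0"
    using entire_no_zero_divisors[of "\<lambda>z. g z ^ (n - 2) * deriv g z" "\<lambda>z. of_nat n * deriv g z - g z"]
    by (force intro: holomorphic_intros)
  then show ?thesis
  proof cases
    case 1
    then consider "\<And>z. g z ^ (n - 2) = 0" | "\<And>z. deriv g z = 0"
      using entire_no_zero_divisors[of "\<lambda>z. g z ^ (n - 2)" "deriv g"] holomorphic
      by (metis holomorphic_on_power)
    then have "g constant_on UNIV"
      using entire_constant_if_derivative_zero[OF hol]
      by cases (auto simp: constant_on_def)
    with nonconst show ?thesis by simp
  next
    case 2
    then show ?thesis by (metis eq_iff_diff_eq_0)
  qed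
qed

text \<open>
Write \<open>L = n g' / g\<close> and \<open>F = g\<^sup>n\<close>. The equation becomes \<open>L\<^sup>2 - L - c = - c / F\<close>, so \<open>L\<close> omits the roots of
\<open>x\<^sup>2 - x - c\<close>. Two distinct roots make \<open>L\<close>, hence \<open>F\<close>, constant. A double root means \<open>c = - 1/4\<close>; then
differentiating gives \<open>2 L' = - L (L - 1/2)\<close>, so \<open>L\<close> either vanishes identically or omits 0 as well as 1/2.
\<close>

lemma ODE_zero_free:
  assumes c: "c \<noteq> 0" and g0: "\<And>z. g z \<noteq> 0"
    and ode: "\<And>z. of_nat n * g z ^ (n - 2) * deriv g z * (of_nat n * deriv g z - g z) = c * (g z ^ n - 1)"
  shows False
proof -
  define L where "L z = of_nat n * deriv g z / g z" for z
  define F where "F z = g z ^ n" for z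
  have F0: "F z \<noteq> 0" for z using g0 by (simp add: F_def)
  have holL: "L holomorphic_on UNIV" unfolding L_def using g0 by (intro holomorphic_intros) auto
  have quad: "(L z)\<^sup>2 - L z - c = - c / F z" for z
  proof -
    obtain m where n: "n = m + 2" using n_ge_2 by (metis add.commute le_Suc_ex)
    have dg: "of_nat n * deriv g z = L z * g z" using g0[of z] by (simp add: L_def)
    have "of_nat n * g z ^ (n - 2) * deriv g z * (of_nat n * deriv g z - g z)
        = g z ^ (n - 2) * (of_nat n * deriv g z) * (of_nat n * deriv g z - g z)" by simp
    also have "\<dots> = g z ^ (n - 2) * (L z * g z) * (L z * g z - g z)" unfolding dg ..
    also have "\<dots> = F z * ((L z)\<^sup>2 - L z)"
      unfolding F_def n by (simp add: algebra_simps power_add power2_eq_square)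
    finally have "F z * ((L z)\<^sup>2 - L z) = c * (F z - 1)" using ode[of z] by (simp add: F_def)
    then show ?thesis using F0[of z] by (simp add: field_simps)
  qed
  have L_nc: "\<not> L constant_on UNIV"
  proof
    assume "L constant_on UNIV"
    then obtain l where l: "\<And>z. L z = l" by (auto simp: constant_on_def)
    have q: "- c / F z = l\<^sup>2 - l - c" for z using quad[of z] by (simp add: l)
    have "F z - 1 = - c / (l\<^sup>2 - l - c) - 1" for z
      using c F0[of z] by (simp add: q[of z, symmetric])
    then show False using power_nonconst by (auto simp: constant_on_def F_def)
  qed
  have omit: "(L z)\<^sup>2 - L z - c \<noteq> 0" for z using quad[of z] F0[of z] c by simp
  define s where "s = csqrt (1 + 4 * c)"
  have s: "s\<^sup>2 = 1 + 4 * c" by (simp add: s_def)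
  have root: "((1 + t) / 2)\<^sup>2 - (1 + t) / 2 - c = 0" if "t\<^sup>2 = 1 + 4 * c" for t
    using that by (simp add: power2_eq_square field_simps)
  have om: "L z \<noteq> (1 + t) / 2" if "t\<^sup>2 = 1 + 4 * c" for t z
  proof
    assume e: "L z = (1 + t) / 2"
    have "(L z)\<^sup>2 - L z - c = 0" unfolding e by (rule root[OF that])
    then show False using omit by blast
  qed
  have s': "(- s)\<^sup>2 = 1 + 4 * c" using s by simp
  have s0: "s = 0"
  proof (rule ccontr)
    assume "s \<noteq> 0"
    then have "(1 + s) / 2 \<noteq> (1 + - s) / 2" by simp
    then show False using entire_omitting_two_values_constant[OF holL _ om[OF s] om[OF s']] L_nc by blast
  qed
  then have c4: "c = - (1 / 4)" using s by (simp add: field_simps eq_neg_iff_add_eq_0)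
  have half: "L z \<noteq> 1 / 2" for z using om[OF s, of z] s0 by simp
  have square: "(L z - 1 / 2)\<^sup>2 = 1 / (4 * F z)" for z
    using quad[of z] by (simp add: c4 power2_eq_square field_simps)
  have L': "deriv L z = - (1 / 2) * (L z - 1 / 2) * L z" for z
  proof -
    have dF: "(F has_field_derivative F z * L z) (at z)"
    proof -
      have "(F has_field_derivative of_nat n * g z ^ (n - 1) * deriv g z) (at z)"
        unfolding F_def by (auto intro!: derivative_eq_intros has_deriv)
      moreover have "g z ^ n = g z * g z ^ (n - 1)" using n_ge_2 by (metis Suc_1 Suc_le_D diff_Suc_1 power_Suc)
      ultimately show ?thesis using g0[of z] by (simp add: F_def L_def mult_ac)
    qed
    have dL: "(L has_field_derivative deriv L z) (at z)"
      by (rule holomorphic_derivI[OF holL]) auto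
    have "((\<lambda>z. (L z - 1 / 2)\<^sup>2) has_field_derivative 2 * (L z - 1 / 2) * deriv L z) (at z)"
      by (auto intro!: derivative_eq_intros dL)
    moreover have "((\<lambda>z. 1 / (4 * F z)) has_field_derivative - L z / (4 * F z)) (at z)"
      using F0[of z] by (auto intro!: derivative_eq_intros dF simp: field_simps)
    ultimately have "2 * (L z - 1 / 2) * deriv L z = - L z / (4 * F z)"
      using square by (simp add: DERIV_unique)
    also have "\<dots> = - L z * (L z - 1 / 2)\<^sup>2" by (simp add: square)
    finally have eq: "2 * (L z - 1 / 2) * deriv L z = - L z * (L z - 1 / 2)\<^sup>2" .
    have cancel: "2 * d = - l * x" if "2 * x * d = - l * x\<^sup>2" "x \<noteq> 0" for x d l :: complex
    proof -
      have "x * (2 * d) = x * (- l * x)" using that(1) by (simp add: power2_eq_square mult_ac)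
      then show ?thesis using that(2) by (simp only: mult_cancel_left) simp
    qed
    have half_eq: "d = - (1 / 2) * x * l" if "2 * d = - l * x" for x d l :: complex
    proof -
      have "d = (2 * d) / 2" by simp
      then show ?thesis unfolding that by simp
    qed
    show ?thesis by (rule half_eq[OF cancel[OF eq]]) (use half[of z] in simp)
  qed
  show False
  proof (cases "\<exists>a. L a = 0")
    case True
    then obtain a where a: "L a = 0" by blast
    have "continuous_on (cball a 1) (\<lambda>z. - (1 / 2) * (L z - 1 / 2))"
      by (intro continuous_intros holomorphic_on_imp_continuous_on holomorphic_on_subset[OF holL]) auto
    then have "bounded ((\<lambda>z. - (1 / 2) * (L z - 1 / 2)) ` cball a 1)"
      by (intro compact_imp_bounded compact_continuous_image compact_cball)
    then obtain B where B: "\<And>z. z \<in> cball a 1 \<Longrightarrow> norm (- (1 / 2) * (L z - 1 / 2)) \<le> B"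
      unfolding bounded_iff by blast
    have "L z = 0" for z
    proof (rule entire_zero_if_derivative_dominated[OF holL, of 1 a B])
      show "norm (deriv L w) \<le> B * norm (L w)" if "w \<in> cball a 1" for w
        unfolding L' norm_mult[of _ "L w"] using B[OF that] by (rule mult_right_mono) simp
    qed (use a in auto)
    then show False using L_nc by (auto simp: constant_on_def)
  next
    case False
    then show False using entire_omitting_two_values_constant[OF holL, of 0 "1 / 2"] half L_nc by auto
  qed
qed

text \<open>
For \<open>n = 2\<close> the equation factors as \<open>A B = - c\<close>, where \<open>A\<close> and \<open>B\<close> are \<open>2 g' - x g\<close> for the two roots \<open>x\<close> of
\<open>x\<^sup>2 - x - c\<close>. So \<open>A\<close> omits 0. If the roots differ, \<open>A\<close> also omits a square root of \<open>c\<close>: there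
\<open>B = - A\<close>, and differentiating \<open>A B = - c\<close> gives \<open>A' = B'\<close>, hence \<open>g' = 0\<close>, hence \<open>g = - A - B = 0\<close> and
\<open>A = 0\<close>. If they coincide, \<open>A\<^sup>2 = 1/4\<close> and \<open>g\<close> is an exponential shifted by 1 or -1; this is
the only place where a point with \<open>(g\<^sup>2)' = 1\<close> and \<open>g\<^sup>2 \<noteq> 1\<close> has to be exhibited.
\<close>

lemma ODE_square:
  assumes c: "c \<noteq> 0" and n: "n = 2"
    and ode: "\<And>z. of_nat n * g z ^ (n - 2) * deriv g z * (of_nat n * deriv g z - g z) = c * (g z ^ n - 1)"
  shows False
proof -
  define s where "s = csqrt (1 + 4 * c)"
  have s: "s\<^sup>2 = 1 + 4 * c" by (simp add: s_def)
  define A where "A z = 2 * deriv g z - (1 + s) / 2 * g z" for z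
  define B where "B z = 2 * deriv g z - (1 - s) / 2 * g z" for z
  have holA: "A holomorphic_on UNIV" and holB: "B holomorphic_on UNIV"
    unfolding A_def B_def by (intro holomorphic_intros)+
  have AB: "A z * B z = - c" for z
  proof -
    have "A z * B z = 4 * (deriv g z)\<^sup>2 - 2 * deriv g z * g z + (1 - s\<^sup>2) / 4 * (g z)\<^sup>2"
      by (simp add: A_def B_def power2_eq_square field_simps)
    also have "(1 - s\<^sup>2) / 4 = - c" by (simp add: s)
    finally have "A z * B z = 2 * deriv g z * (2 * deriv g z - g z) - c * (g z)\<^sup>2"
      by (simp add: power2_eq_square algebra_simps)
    also have "2 * deriv g z * (2 * deriv g z - g z) = c * ((g z)\<^sup>2 - 1)"
      using ode[of z] by (simp add: n)
    finally show ?thesis by (simp add: algebra_simps)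
  qed
  have A0: "A z \<noteq> 0" for z using AB[of z] c by auto
  have diff: "B z - A z = s * g z" for z by (simp add: A_def B_def field_simps)
  show False
  proof (cases "s = 0")
    case False
    have om: "A z \<noteq> csqrt c" for z
    proof
      assume "A z = csqrt c"
      then have "(A z)\<^sup>2 = c" by simp
      then have BA: "B z = - A z"
        using AB[of z] A0[of z] by (metis minus_mult_right mult_left_cancel power2_eq_square)
      have dA: "(A has_field_derivative deriv A z) (at z)" and dB: "(B has_field_derivative deriv B z) (at z)"
        using holomorphic_derivI[OF holA] holomorphic_derivI[OF holB] by auto
      have "((\<lambda>z. A z * B z) has_field_derivative deriv A z * B z + deriv B z * A z) (at z)"
        by (rule DERIV_mult[OF dA dB])
      then have "deriv A z * B z + deriv B z * A z = 0" unfolding AB by (rule DERIV_unique) simp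
      then have "deriv B z - deriv A z = 0" using A0[of z] BA
        by (metis (no_types, lifting) add.commute diff_conv_add_uminus left_diff_distrib mult_eq_0_iff mult_minus_right)
      moreover have "((\<lambda>z. B z - A z) has_field_derivative deriv B z - deriv A z) (at z)"
        by (rule DERIV_diff[OF dB dA])
      then have "deriv B z - deriv A z = s * deriv g z"
        unfolding diff by (rule DERIV_unique) (auto intro!: derivative_eq_intros has_deriv)
      ultimately have "deriv g z = 0" using False by simp
      then have "A z + B z = - g z" by (simp add: A_def B_def field_simps)
      then show False using BA A0[of z] \<open>deriv g z = 0\<close> by (simp add: A_def)
    qed
    have "A constant_on UNIV"
      using entire_omitting_two_values_constant[OF holA _ A0 om] c by simp
    then obtain a where a: "\<And>z. A z = a" by (auto simp: constant_on_def)
    have "a \<noteq> 0" using A0 a by metis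
    then have "B z = - c / a" for z using AB[of z] by (simp add: a field_simps)
    then have "g z = (- c / a - a) / s" for z using diff[of z] a[of z] False by (simp add: field_simps)
    then show False using nonconst by (auto simp: constant_on_def)
  next
    case True
    then have c4: "c = - (1 / 4)" using s by (simp add: field_simps eq_neg_iff_add_eq_0)
    have A_eq: "A z = 2 * deriv g z - g z / 2" for z by (simp add: A_def True)
    have A2: "A z * A z = 1 / 4" for z using AB[of z] diff[of z] True c4 by simp
    have "A z \<noteq> 1" for z using A2[of z] by auto
    then have "A constant_on UNIV"
      using entire_omitting_two_values_constant[OF holA, of 0 1] A0 by auto
    then obtain a where a: "\<And>z. A z = a" by (auto simp: constant_on_def)
    define \<sigma> where "\<sigma> = 2 * a"
    have \<sigma>: "\<sigma> * \<sigma> = 1" using A2[of 0] by (simp add: a \<sigma>_def mult_ac)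
    have g': "deriv g z = (g z + \<sigma>) / 4" for z
      using a[of z] unfolding A_eq \<sigma>_def by (simp add: field_simps)
    have "((\<lambda>z. (g z + \<sigma>) * exp (- z / 4)) has_field_derivative 0) (at z)" for z
      by (auto intro!: derivative_eq_intros has_deriv simp: g' field_simps)
    then obtain k where k: "\<And>z. (g z + \<sigma>) * exp (- z / 4) = k"
      using has_field_derivative_zero_constant[of UNIV "\<lambda>z. (g z + \<sigma>) * exp (- z / 4)"] by auto
    have gk: "g z + \<sigma> = k * exp (z / 4)" for z
      using k[of z] by (simp add: exp_minus field_simps)
    have "k \<noteq> 0"
    proof
      assume "k = 0"
      then have "g z = - \<sigma>" for z using gk[of z] by (simp add: eq_neg_iff_add_eq_0)
      then show False using nonconst by (auto simp: constant_on_def)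
    qed
    have "\<sigma> \<noteq> 0" using \<sigma> by auto
    \<comment> \<open>at this point \<open>g = - 2 \<sigma>\<close> and \<open>g' = - \<sigma> / 4\<close>, so that \<open>2 g g' = 1\<close> but \<open>g\<^sup>2 = 4\<close>\<close>
    define z where "z = 4 * Ln (- \<sigma> / k)"
    have "g z + \<sigma> = - \<sigma>" unfolding gk z_def using \<open>k \<noteq> 0\<close> \<open>\<sigma> \<noteq> 0\<close> by simp
    then have gz: "g z = - 2 * \<sigma>" by (simp add: algebra_simps eq_neg_iff_add_eq_0)
    have "deriv g z = - \<sigma> / 4" by (simp add: g' gz)
    then have "of_nat n * g z ^ (n - 1) * deriv g z = 1" using \<sigma> by (simp add: n gz)
    then have "g z ^ n = 1" using share by simp
    then show False using \<sigma> by (simp add: n gz power2_eq_square)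
  qed
qed

text \<open>
If \<open>c \<noteq> 0\<close> and \<open>n \<ge> 3\<close>, a zero of \<open>g\<close> would make the left-hand side of the equation vanish but not the right-hand
side; only \<open>n = 2\<close> has to deal with zeros of \<open>g\<close>.
\<close>

lemma eq_n_times_derivative: "g z = of_nat n * deriv g z"
proof -
  obtain c where c: "\<And>z. of_nat n * g z ^ (n - 2) * deriv g z * (of_nat n * deriv g z - g z) = c * (g z ^ n - 1)"
    using ODE_constant_quotient by blast
  have "c = 0"
  proof (rule ccontr)
    assume c0: "c \<noteq> 0"
    show False
    proof (cases "n = 2")
      case True
      then show False using ODE_square[OF c0 _ c] by simp
    next
      case False
      then have "g z \<noteq> 0" for z using c[of z] c0 n_ge_2 by (auto simp: power_0_left)
      then show False using ODE_zero_free[OF c0 _ c] by blast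
    qed
  qed
  then show ?thesis using ODE_zero_quotient c by simp
qed

end

section \<open>Entire functions of several variables\<close>

lemma bounded_linear_scalar_vector: "bounded_linear (\<lambda>t::complex. t *s (v :: complex ^ 'm::finite))"
  by (rule bounded_linearI') (simp_all add: vec_eq_iff distrib_right)

lemma has_derivative_line:
  "((\<lambda>t::complex. a + t *s (v :: complex ^ 'm::finite)) has_derivative (\<lambda>t. t *s v)) (at t)"
  using has_derivative_add[OF has_derivative_const
      bounded_linear.has_derivative[OF bounded_linear_scalar_vector[of v] has_derivative_ident]]
  by simp

lemma complex_derivative_along_line:
  fixes f :: "complex ^ 'm::finite \<Rightarrow> complex"
  assumes D: "(f has_derivative D) (at (a + t *s v))" and lin: "\<And>c v. D (c *s v) = c * D v"
  shows "((\<lambda>t. f (a + t *s v)) has_field_derivative D v) (at t)"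
  using has_derivative_compose[OF has_derivative_line D]
  by (simp add: has_field_derivative_def lin mult.commute[of _ "D v"])

text \<open>
A complex-linear derivative is determined by its values on the basis vectors, and these are the partial
derivatives.
\<close>

lemma derivative_eq_dir_deriv:
  fixes f :: "complex ^ 'm::finite \<Rightarrow> complex"
  assumes D: "(f has_derivative D) (at z)" and lin: "\<And>c v. D (c *s v) = c * D v"
  shows "D = (\<lambda>v. dir_deriv v f z)"
proof
  fix v
  have "((\<lambda>t. f (z + t *s axis j 1)) has_field_derivative D (axis j 1)) (at 0)" for j
    using complex_derivative_along_line[of f D z 0 "axis j 1"] D lin by simp
  then have pd: "partial_deriv j f z = D (axis j 1)" for j
    unfolding partial_deriv_def by (rule DERIV_imp_deriv)
  have "D v = D (\<Sum>j\<in>UNIV. (v $ j) *s axis j 1)" by (simp only: basis_expansion)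
  also have "\<dots> = (\<Sum>j\<in>UNIV. v $ j * D (axis j 1))"
    by (simp add: linear_sum[OF has_derivative_linear[OF D]] lin)
  finally show "D v = dir_deriv v f z" by (simp add: dir_deriv_def pd)
qed

lemma entire_has_derivative:
  assumes "entire f"
  shows "(f has_derivative (\<lambda>v. dir_deriv v f z)) (at z)"
proof -
  obtain D where "(f has_derivative D) (at z)" "\<And>c v. D (c *s v) = c * D v"
    using assms unfolding entire_def by blast
  then show ?thesis using derivative_eq_dir_deriv[of f D z] by simp
qed

lemma dir_deriv_scale: "dir_deriv (c *s v) f z = c * dir_deriv v f z"
  by (simp add: dir_deriv_def sum_distrib_left mult.assoc)

lemma dir_deriv_unique:
  assumes "(f has_derivative D) (at z)" "\<And>c v. D (c *s v) = c * D v"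
  shows "dir_deriv v f z = D v"
  using derivative_eq_dir_deriv[OF assms] by simp

lemma entire_on_line:
  assumes "entire f"
  shows "((\<lambda>t. f (a + t *s v)) has_field_derivative dir_deriv v f (a + t *s v)) (at t)"
  by (rule complex_derivative_along_line[OF entire_has_derivative[OF assms] dir_deriv_scale])

lemma entire_on_line_holomorphic:
  assumes "entire f"
  shows "(\<lambda>t. f (a + t *s v)) holomorphic_on S"
  unfolding holomorphic_on_def field_differentiable_def
  using has_field_derivative_at_within[OF entire_on_line[OF assms]] by blast

lemma continuous_on_entire: "entire f \<Longrightarrow> continuous_on S f"
  by (intro continuous_at_imp_continuous_on ballI has_derivative_continuous[OF entire_has_derivative])

lemma entire_const: "entire (\<lambda>_. c)"
  unfolding entire_def by (intro allI exI[of _ "\<lambda>_. 0"]) auto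

lemma entire_coord: "entire (\<lambda>z. z $ j)"
  unfolding entire_def
  by (intro allI exI[of _ "\<lambda>v. v $ j"])
     (auto intro!: bounded_linear.has_derivative[OF bounded_linear_vec_nth])

lemma entire_mult:
  assumes "entire f" "entire g" shows "entire (\<lambda>z. f z * g z)"
  unfolding entire_def
proof (intro allI exI conjI)
  fix z
  show "((\<lambda>z. f z * g z) has_derivative (\<lambda>v. f z * dir_deriv v g z + dir_deriv v f z * g z)) (at z)"
    by (intro derivative_intros entire_has_derivative assms)
qed (simp add: dir_deriv_scale algebra_simps)

lemma entire_diff:
  assumes "entire f" "entire g" shows "entire (\<lambda>z. f z - g z)"
  unfolding entire_def
proof (intro allI exI conjI)
  fix z
  show "((\<lambda>z. f z - g z) has_derivative (\<lambda>v. dir_deriv v f z - dir_deriv v g z)) (at z)"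
    by (intro derivative_intros entire_has_derivative assms)
qed (simp add: dir_deriv_scale algebra_simps)

lemma has_derivative_compose_entire:
  assumes f: "entire f" and p: "(p has_field_derivative p') (at (f z))"
  shows "((\<lambda>z. p (f z)) has_derivative (\<lambda>v. p' * dir_deriv v f z)) (at z)"
  using has_derivative_compose[OF entire_has_derivative[OF f] p[unfolded has_field_derivative_def]] .

lemma entire_compose:
  assumes f: "entire f" and p: "\<And>w. (p has_field_derivative p' w) (at w)"
  shows "entire (\<lambda>z. p (f z))"
  unfolding entire_def
proof (intro allI exI conjI)
  fix z
  show "((\<lambda>z. p (f z)) has_derivative (\<lambda>v. p' (f z) * dir_deriv v f z)) (at z)"
    by (rule has_derivative_compose_entire[OF f p])
qed (simp add: dir_deriv_scale algebra_simps)

lemma has_field_derivative_power_fun: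
  "((\<lambda>w::complex. w ^ n) has_field_derivative of_nat n * w ^ (n - 1)) (at w)"
  by (auto intro!: derivative_eq_intros)

lemma dir_deriv_power:
  assumes "entire f"
  shows "dir_deriv u (\<lambda>z. f z ^ n) z = of_nat n * f z ^ (n - 1) * dir_deriv u f z"
  by (rule dir_deriv_unique[OF has_derivative_compose_entire[OF assms has_field_derivative_power_fun]])
     (auto simp: dir_deriv_scale algebra_simps)

lemma entire_power: "entire f \<Longrightarrow> entire (\<lambda>z. f z ^ n)"
  by (erule entire_compose) (rule has_field_derivative_power_fun)

text \<open>
Cauchy's formula for the derivative of \<open>t \<mapsto> f (z + t v)\<close> at 0 on the unit circle. It expresses the directional
derivative by values of \<open>f\<close> alone, which makes it continuous and then differentiable in \<open>z\<close>.
\<close>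

lemma Cauchy_dir_deriv:
  fixes f :: "complex ^ 'm::finite \<Rightarrow> complex"
  assumes f: "entire f"
  defines "e \<equiv> (\<lambda>x::real. exp (2 * of_real pi * \<i> * of_real x))"
  shows "dir_deriv v f z = integral (cbox 0 1) (\<lambda>x. f (z + e x *s v) / e x)"
proof -
  define q where "q t = f (z + t *s v)" for t
  have q: "q holomorphic_on S" for S unfolding q_def by (rule entire_on_line_holomorphic[OF f])
  have dq: "deriv q 0 = dir_deriv v f z"
    using entire_on_line[OF f, of z v 0] unfolding q_def by (simp add: DERIV_imp_deriv)
  have "((\<lambda>u. q u / (u - 0) ^ Suc 1) has_contour_integral (2 * pi * \<i>) / fact 1 * (deriv ^^ 1) q 0)
      (circlepath 0 1)"
    by (rule Cauchy_has_contour_integral_higher_derivative_circlepath)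
       (auto intro: q holomorphic_on_imp_continuous_on)
  then have "((\<lambda>u. q u / u\<^sup>2) has_contour_integral (2 * pi * \<i>) * dir_deriv v f z) (circlepath 0 1)"
    by (simp add: dq power2_eq_square)
  then have "((\<lambda>x. q (e x) / (e x)\<^sup>2 * (2 * pi * \<i> * e x)) has_integral
      (2 * pi * \<i>) * dir_deriv v f z) {0..1}"
    unfolding has_contour_integral vector_derivative_circlepath by (simp add: circlepath e_def)
  from has_integral_mult_right[OF this, of "1 / (2 * pi * \<i>)"]
  have "((\<lambda>x. q (e x) / e x) has_integral dir_deriv v f z) {0..1}"
    by (simp add: e_def power2_eq_square field_simps)
  then show ?thesis by (simp add: q_def integral_unique)
qed

lemma continuous_on_scalar_vector [continuous_intros]:
  fixes g :: "'a::topological_space \<Rightarrow> complex" and h :: "'a \<Rightarrow> complex ^ 'm::finite"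
  assumes "continuous_on S g" "continuous_on S h"
  shows "continuous_on S (\<lambda>x. g x *s h x)"
  unfolding vector_scalar_mult_def
  by (intro continuous_on_vec_lambda continuous_intros continuous_on_component assms)

lemma continuous_on_dir_deriv:
  fixes f :: "complex ^ 'm::finite \<Rightarrow> complex"
  assumes f: "entire f"
  shows "continuous_on UNIV (dir_deriv v f)"
proof -
  define e where "e = (\<lambda>x::real. exp (2 * of_real pi * \<i> * of_real x))"
  have "continuous_on UNIV (\<lambda>z. integral (cbox 0 1) (\<lambda>x. f (z + e x *s v) / e x))"
  proof (rule integral_continuous_on_param)
    have "continuous_on (UNIV \<times> cbox 0 1) (\<lambda>p. f (fst p + e (snd p) *s v) / e (snd p))"
      unfolding e_def
      by (intro continuous_intros continuous_on_compose2[OF continuous_on_entire[OF f, of UNIV]]) auto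
    then show "continuous_on (UNIV \<times> cbox 0 1) (\<lambda>(z, x). f (z + e x *s v) / e x)"
      by (simp add: case_prod_beta')
  qed
  then show ?thesis unfolding e_def Cauchy_dir_deriv[OF f, symmetric] .
qed

text \<open>
Differentiation under the integral sign in \<open>Cauchy_dir_deriv\<close>; the derivative is complex-linear because the
integrand is.
\<close>

lemma entire_dir_deriv:
  fixes f :: "complex ^ 'm::finite \<Rightarrow> complex"
  assumes f: "entire f"
  shows "entire (dir_deriv u f)"
  unfolding entire_def
proof
  fix z
  define e where "e = (\<lambda>x::real. exp (2 * of_real pi * \<i> * of_real x))"
  define Df where "Df w = Blinfun (\<lambda>v. dir_deriv v f w)" for w
  have Df: "blinfun_apply (Df w) v = dir_deriv v f w" for w v
    unfolding Df_def
    by (subst bounded_linear_Blinfun_apply) (rule has_derivative_bounded_linear[OF entire_has_derivative[OF f]], rule refl)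
  define k where "k z x = blinfun_compose (blinfun_mult_right (1 / e x)) (Df (z + e x *s u))" for z x
  have k: "blinfun_apply (k z x) v = dir_deriv v f (z + e x *s u) / e x" for z x v
    by (simp add: k_def Df)
  have conte: "continuous_on S (\<lambda>x. e (h x))" if "continuous_on S h" for S and h :: "'b::topological_space \<Rightarrow> _"
    unfolding e_def by (intro continuous_intros that)
  have e0: "e x \<noteq> 0" for x by (simp add: e_def)
  have contk: "continuous_on (UNIV \<times> cbox 0 1) (\<lambda>(z, x). k z x)"
  proof (rule continuous_on_blinfun_componentwise)
    fix i :: "complex ^ 'm"
    have "continuous_on (UNIV \<times> cbox 0 1) (\<lambda>p. dir_deriv i f (fst p + e (snd p) *s u) / e (snd p))"
      by (intro continuous_intros conte continuous_on_compose2[OF continuous_on_dir_deriv[OF f]]) (auto simp: e0)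
    then show "continuous_on (UNIV \<times> cbox 0 1) (\<lambda>p. blinfun_apply (case p of (z, x) \<Rightarrow> k z x) i)"
      by (simp add: case_prod_beta' k)
  qed
  have "((\<lambda>z. integral (cbox 0 1) (\<lambda>x. f (z + e x *s u) / e x)) has_derivative
      blinfun_apply (integral (cbox 0 1) (k z))) (at z within UNIV)"
  proof (rule leibniz_rule[OF _ _ contk])
    fix w :: "complex ^ 'm" and x :: real
    have "((\<lambda>w. w + e x *s u) has_derivative (\<lambda>v. v)) (at w)"
      using has_derivative_add[OF has_derivative_ident has_derivative_const[of "e x *s u"]] by simp
    then have "((\<lambda>w. f (w + e x *s u)) has_derivative (\<lambda>v. dir_deriv v f (w + e x *s u))) (at w)"
      by (rule has_derivative_compose[OF _ entire_has_derivative[OF f]])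
    then have "((\<lambda>w. f (w + e x *s u) * (1 / e x)) has_derivative (\<lambda>v. dir_deriv v f (w + e x *s u) * (1 / e x))) (at w)"
      by (rule has_derivative_mult_left)
    moreover have "blinfun_apply (k w x) = (\<lambda>v. dir_deriv v f (w + e x *s u) * (1 / e x))"
      by (simp add: k fun_eq_iff)
    ultimately show "((\<lambda>w. f (w + e x *s u) / e x) has_derivative blinfun_apply (k w x)) (at w within UNIV)"
      by simp
  next
    fix w :: "complex ^ 'm"
    show "(\<lambda>x. f (w + e x *s u) / e x) integrable_on cbox 0 1"
      by (intro integrable_continuous continuous_intros conte
          continuous_on_compose2[OF continuous_on_entire[OF f, of UNIV]]) (auto simp: e0)
  qed auto
  then have "(dir_deriv u f has_derivative blinfun_apply (integral (cbox 0 1) (k z))) (at z)"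
    unfolding e_def Cauchy_dir_deriv[OF f, symmetric] by simp
  moreover have "blinfun_apply (integral (cbox 0 1) (k z)) (c *s v) = c * blinfun_apply (integral (cbox 0 1) (k z)) v" for c v
  proof -
    have "continuous_on (cbox 0 1) (\<lambda>x. (\<lambda>(z, x). k z x) (z, x))"
      by (rule continuous_on_compose2[OF contk]) (auto intro!: continuous_intros)
    then have "k z integrable_on cbox 0 1" by (intro integrable_continuous) simp
    then have "blinfun_apply (integral (cbox 0 1) (k z)) (c *s v)
        = integral (cbox 0 1) (\<lambda>x. c * blinfun_apply (k z x) v)"
      by (simp add: blinfun_apply_integral k dir_deriv_scale)
    also have "\<dots> = c * integral (cbox 0 1) (\<lambda>x. blinfun_apply (k z x) v)"
      by (rule integral_mult_right)
    finally show ?thesis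
      using \<open>k z integrable_on cbox 0 1\<close> by (simp add: blinfun_apply_integral)
  qed
  ultimately show "\<exists>D. (dir_deriv u f has_derivative D) (at z) \<and> (\<forall>c v. D (c *s v) = c * D v)" by blast
qed

section \<open>Homogeneous expansions and zero multiplicities\<close>

lemma finite_multi_indices: "finite {k :: 'm::finite \<Rightarrow> nat. (\<Sum>i\<in>UNIV. k i) = d}"
proof (rule finite_subset)
  have "k i \<le> (\<Sum>i\<in>UNIV. k i)" for k :: "'m \<Rightarrow> nat" and i by (rule member_le_sum) auto
  then show "{k :: 'm \<Rightarrow> nat. (\<Sum>i\<in>UNIV. k i) = d} \<subseteq> PiE UNIV (\<lambda>_. {..d})" by auto
  show "finite (PiE UNIV (\<lambda>_ :: 'm. {..d}))" by (rule finite_PiE) auto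
qed

lemma homogeneous_poly_cmult:
  assumes "homogeneous_poly d P" shows "homogeneous_poly d (\<lambda>w. a * P w)"
proof -
  obtain c where "\<And>w. P w = (\<Sum>k\<in>{k. (\<Sum>i\<in>UNIV. k i) = d}. c k * (\<Prod>i\<in>UNIV. w $ i ^ k i))"
    using assms unfolding homogeneous_poly_def by blast
  then show ?thesis
    unfolding homogeneous_poly_def
    by (intro exI[of _ "\<lambda>k. a * c k"]) (simp add: sum_distrib_left mult.assoc)
qed

lemma homogeneous_poly_sum:
  assumes "\<And>j. j \<in> J \<Longrightarrow> homogeneous_poly d (P j)"
  shows "homogeneous_poly d (\<lambda>w. \<Sum>j\<in>J. P j w)"
proof -
  have "\<forall>j\<in>J. \<exists>c. \<forall>w. P j w = (\<Sum>k\<in>{k. (\<Sum>i\<in>UNIV. k i) = d}. c k * (\<Prod>i\<in>UNIV. w $ i ^ k i))"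
    using assms unfolding homogeneous_poly_def by blast
  from bchoice[OF this] obtain c where "\<And>j w. j \<in> J \<Longrightarrow>
      P j w = (\<Sum>k\<in>{k. (\<Sum>i\<in>UNIV. k i) = d}. c j k * (\<Prod>i\<in>UNIV. w $ i ^ k i))"
    by blast
  then have "(\<Sum>j\<in>J. P j w) = (\<Sum>k\<in>{k. (\<Sum>i\<in>UNIV. k i) = d}. (\<Sum>j\<in>J. c j k) * (\<Prod>i\<in>UNIV. w $ i ^ k i))" for w
    by (simp add: sum_distrib_right) (rule sum.swap)
  then show ?thesis unfolding homogeneous_poly_def by (intro exI[of _ "\<lambda>k. \<Sum>j\<in>J. c j k"]) simp
qed

lemma homogeneous_poly_coord_mult:
  fixes P :: "complex ^ 'm::finite \<Rightarrow> complex"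
  assumes "homogeneous_poly d P"
  shows "homogeneous_poly (Suc d) (\<lambda>w. w $ j * P w)"
proof -
  obtain c where c: "\<And>w. P w = (\<Sum>k\<in>{k. (\<Sum>i\<in>UNIV. k i) = d}. c k * (\<Prod>i\<in>UNIV. w $ i ^ k i))"
    using assms unfolding homogeneous_poly_def by blast
  define up where "up k = k(j := Suc (k j))" for k :: "'m \<Rightarrow> nat"
  define down where "down k = k(j := k j - 1)" for k :: "'m \<Rightarrow> nat"
  define c' where "c' k = (if k j = 0 then 0 else c (down k))" for k
  have down_up: "down (up k) = k" for k by (simp add: up_def down_def)
  have up_down: "up (down k) = k" if "k j \<noteq> 0" for k using that by (simp add: up_def down_def)
  have sum_up: "(\<Sum>i\<in>UNIV. up k i) = Suc (\<Sum>i\<in>UNIV. k i)" for k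
    by (simp add: up_def sum.remove[of UNIV j])
  have prod_up: "(\<Prod>i\<in>UNIV. w $ i ^ up k i) = w $ j * (\<Prod>i\<in>UNIV. w $ i ^ k i)" for k and w :: "complex ^ 'm"
    by (simp add: up_def prod.remove[of UNIV j] mult.assoc)
  have "w $ j * P w = (\<Sum>k\<in>{k. (\<Sum>i\<in>UNIV. k i) = Suc d}. c' k * (\<Prod>i\<in>UNIV. w $ i ^ k i))" for w
  proof -
    have "w $ j * P w = (\<Sum>k\<in>{k. (\<Sum>i\<in>UNIV. k i) = d}. c k * (\<Prod>i\<in>UNIV. w $ i ^ up k i))"
      unfolding c sum_distrib_left prod_up by (simp add: mult_ac)
    also have "\<dots> = (\<Sum>k\<in>{k. (\<Sum>i\<in>UNIV. k i) = Suc d \<and> k j \<noteq> 0}. c (down k) * (\<Prod>i\<in>UNIV. w $ i ^ k i))"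
    proof (rule sum.reindex_bij_witness[of _ down up])
      fix k assume k: "k \<in> {k. (\<Sum>i\<in>UNIV. k i) = Suc d \<and> k j \<noteq> 0}"
      then show "up (down k) = k" by (simp add: up_down)
      then show "down k \<in> {k. (\<Sum>i\<in>UNIV. k i) = d}" using k sum_up[of "down k"] by simp
    next
      fix k :: "'m \<Rightarrow> nat" assume "k \<in> {k. (\<Sum>i\<in>UNIV. k i) = d}"
      then show "up k \<in> {k. (\<Sum>i\<in>UNIV. k i) = Suc d \<and> k j \<noteq> 0}"
        using sum_up[of k] by (simp add: up_def)
    qed (simp_all add: down_up)
    also have "\<dots> = (\<Sum>k\<in>{k. (\<Sum>i\<in>UNIV. k i) = Suc d}. c' k * (\<Prod>i\<in>UNIV. w $ i ^ k i))"
      by (rule sum.mono_neutral_cong_left[OF finite_multi_indices]) (auto simp: c'_def)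
    finally show ?thesis .
  qed
  then show ?thesis unfolding homogeneous_poly_def by blast
qed

lemma higher_deriv_sum_cmult:
  fixes q :: "'j \<Rightarrow> complex \<Rightarrow> complex"
  assumes "finite J" "\<And>j. q j holomorphic_on UNIV"
  shows "(deriv ^^ i) (\<lambda>t. \<Sum>j\<in>J. c j * q j t) x = (\<Sum>j\<in>J. c j * (deriv ^^ i) (q j) x)"
  using assms(1)
proof (induction J)
  case empty
  have "(deriv ^^ i) (\<lambda>t::complex. 0) = (\<lambda>t. 0)" by (induction i) auto
  then show ?case by simp
next
  case (insert j J)
  have "(deriv ^^ i) (\<lambda>t. c j * q j t + (\<Sum>j\<in>J. c j * q j t)) x
      = (deriv ^^ i) (\<lambda>t. c j * q j t) x + (deriv ^^ i) (\<lambda>t. \<Sum>j\<in>J. c j * q j t) x"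
    by (rule higher_deriv_add[of _ UNIV]) (auto intro!: holomorphic_intros assms(2))
  also have "(deriv ^^ i) (\<lambda>t. c j * q j t) x = c j * (deriv ^^ i) (q j) x"
    by (rule higher_deriv_cmult[of _ UNIV]) (use assms(2) in auto)
  finally show ?case unfolding sum.insert[OF insert.hyps] insert.IH .
qed

text \<open>
By induction: the first derivative of \<open>t \<mapsto> h (a + t w)\<close> is the sum of \<open>w\<^sub>j\<close> times the \<open>j\<close>-th partial derivative
along the same line, and the partial derivatives are again entire.
\<close>

lemma homogeneous_poly_line_derivative:
  fixes h :: "complex ^ 'm::finite \<Rightarrow> complex"
  assumes "entire h"
  shows "homogeneous_poly i (\<lambda>w. (deriv ^^ i) (\<lambda>t. h (a + t *s w)) 0)"
  using assms
proof (induction i arbitrary: h)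
  case 0
  have "{k :: 'm \<Rightarrow> nat. (\<Sum>i\<in>UNIV. k i) = 0} = {\<lambda>_. 0}" by auto
  then show ?case unfolding homogeneous_poly_def by (intro exI[of _ "\<lambda>_. h a"]) simp
next
  case (Suc i)
  have ent: "entire (dir_deriv (axis j 1) h)" for j by (rule entire_dir_deriv[OF Suc.prems])
  have eq: "(deriv ^^ Suc i) (\<lambda>t. h (a + t *s w)) 0
      = (\<Sum>j\<in>UNIV. w $ j * (deriv ^^ i) (\<lambda>t. dir_deriv (axis j 1) h (a + t *s w)) 0)" for w
  proof -
    have axis: "dir_deriv (axis j 1) h z = partial_deriv j h z" for j z
    proof -
      have "(axis j 1 :: complex ^ 'm) $ k * partial_deriv k h z = (if k = j then partial_deriv k h z else 0)" for k
        by (simp add: axis_def)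
      then show ?thesis by (simp add: dir_deriv_def)
    qed
    have "deriv (\<lambda>t. h (a + t *s w)) = (\<lambda>t. \<Sum>j\<in>UNIV. w $ j * dir_deriv (axis j 1) h (a + t *s w))"
    proof
      fix t
      show "deriv (\<lambda>t. h (a + t *s w)) t = (\<Sum>j\<in>UNIV. w $ j * dir_deriv (axis j 1) h (a + t *s w))"
        unfolding DERIV_imp_deriv[OF entire_on_line[OF Suc.prems]] axis by (rule dir_deriv_def)
    qed
    then show ?thesis
      unfolding funpow_Suc_right comp_def
      by (simp only: higher_deriv_sum_cmult[OF finite_class.finite_UNIV entire_on_line_holomorphic[OF ent]])
  qed
  show ?case
    unfolding eq by (intro homogeneous_poly_sum homogeneous_poly_coord_mult Suc.IH ent)
qed

text \<open>
The terms of the expansion are the Taylor terms of \<open>t \<mapsto> h (a + t w)\<close> at 0, and the Taylor series is taken at \<open>t = 1\<close>.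
\<close>

lemma entire_homogeneous_expansion:
  assumes h: "entire h"
  shows "\<exists>P. homogeneous_expansion h a P"
proof -
  define P where "P i w = 1 / fact i * (deriv ^^ i) (\<lambda>t. h (a + t *s w)) 0" for i w
  have "homogeneous_poly i (P i)" for i
    unfolding P_def by (intro homogeneous_poly_cmult homogeneous_poly_line_derivative h)
  moreover have "(\<lambda>i. P i (z - a)) sums h z" for z
  proof -
    have one: "(1::complex) \<in> ball 0 2" by simp
    have scale: "x / fact i * (1 - 0) ^ i = 1 / fact i * x" for x :: complex and i by simp
    have end_point: "a + 1 *s (z - a) = z" by simp
    show ?thesis
      using holomorphic_power_series[OF entire_on_line_holomorphic[OF h, of a "z - a"] one]
      unfolding P_def scale end_point .
  qed
  ultimately have "homogeneous_expansion h a P" by (simp add: homogeneous_expansion_def)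
  then show ?thesis by blast
qed

text \<open>
The degree-0 term of the expansion is the constant \<open>h a\<close>.
\<close>

lemma zero_mult_eq_0_iff:
  assumes "entire h"
  shows "min (zero_mult h a) 1 = 0 \<longleftrightarrow> h a \<noteq> 0"
proof -
  define P where "P = (SOME P. homogeneous_expansion h a P)"
  have P: "homogeneous_expansion h a P"
    unfolding P_def by (rule someI_ex[OF entire_homogeneous_expansion[OF assms]])
  have at0: "P i 0 = 0 ^ i * P i w" for i w
    using P homogeneous_poly_scale[of i "P i" 0 w] by (simp add: homogeneous_expansion_def)
  have "(\<lambda>i. P i (a - a)) sums h a"
    using P eventually_nhds_x_imp_x unfolding homogeneous_expansion_def by blast
  then have "(\<lambda>i. P i 0) sums h a" by simp
  moreover have "(\<lambda>i. P i 0) sums (\<Sum>i\<in>{0}. P i 0)"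
  proof (rule sums_finite)
    show "P i 0 = 0" if "i \<notin> {0}" for i
      using at0[of i 0] that by (simp add: power_0_left)
  qed simp
  ultimately have "h a = P 0 0" by (simp add: sums_unique2)
  then have P0: "P 0 w = h a" for w using at0[of 0 w] by simp
  define S where "S = {i. \<exists>w. P i w \<noteq> 0}"
  have zm: "zero_mult h a = Inf (enat ` S)" by (simp add: zero_mult_def S_def P_def)
  show ?thesis
  proof (cases "h a = 0")
    case True
    then have "0 \<notin> S" by (simp add: S_def P0)
    have "1 \<le> Inf (enat ` S)"
    proof (rule Inf_greatest)
      fix x assume "x \<in> enat ` S"
      then obtain i where "i \<in> S" "x = enat i" by blast
      moreover have "i \<noteq> 0" using \<open>i \<in> S\<close> \<open>0 \<notin> S\<close> by metis
      ultimately show "1 \<le> x" by (simp add: one_enat_def)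
    qed
    then have "Inf (enat ` S) \<noteq> 0" by (metis not_one_le_zero)
    then show ?thesis using True by (simp add: zm min_def)
  next
    case False
    then have "0 \<in> S" by (simp add: S_def P0)
    then have "Inf (enat ` S) \<le> enat 0" by (intro Inf_lower) auto
    then show ?thesis using False by (simp add: zm zero_enat_def[symmetric])
  qed
qed

text \<open>
Truncation at 1 leaves of the multiplicity only whether it is zero.
\<close>

lemma share_IM_iff:
  assumes "entire F" "entire G"
  shows "share_IM F G c \<longleftrightarrow> (\<forall>z. F z = c \<longleftrightarrow> G z = c)"
proof -
  have F: "min (zero_mult (\<lambda>z. F z - c) a) 1 = 0 \<longleftrightarrow> F a \<noteq> c" for a
    using zero_mult_eq_0_iff[OF entire_diff[OF assms(1) entire_const]] by simp
  have G: "min (zero_mult (\<lambda>z. G z - c) a) 1 = 0 \<longleftrightarrow> G a \<noteq> c" for a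
    using zero_mult_eq_0_iff[OF entire_diff[OF assms(2) entire_const]] by simp
  have "min x 1 = (if x = 0 then 0 else 1)" for x :: enat
  proof (cases "x = 0")
    case False
    then have "1 \<le> x" using ileI1[of 0 x] by (simp add: one_eSuc)
    with False show ?thesis by (simp add: min_absorb2)
  qed simp
  then have "min x 1 = min y 1 \<longleftrightarrow> (min x 1 = 0 \<longleftrightarrow> min y 1 = 0)" for x y :: enat by simp
  then have "min (zero_mult (\<lambda>z. F z - c) a) 1 = min (zero_mult (\<lambda>z. G z - c) a) 1
      \<longleftrightarrow> (F a \<noteq> c \<longleftrightarrow> G a \<noteq> c)" for a
    by (simp only: F[symmetric] G[symmetric])
  then show ?thesis unfolding share_IM_def by auto
qed

lemma entire_compose_linear:
  assumes f: "entire f" and l: "bounded_linear l" "\<And>c v. l (c *s v) = c *s l v"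
  shows "entire (\<lambda>z. f (l z))"
  unfolding entire_def
proof (intro allI exI conjI)
  fix z
  show "((\<lambda>z. f (l z)) has_derivative (\<lambda>v. dir_deriv (l v) f (l z))) (at z)"
    by (rule has_derivative_compose[OF bounded_linear_imp_has_derivative[OF l(1)] entire_has_derivative[OF f]])
qed (simp add: l(2) dir_deriv_scale)

text \<open>
A continuous logarithm exists because the whole space is contractible. Near each point \<open>a\<close> it coincides with
\<open>\<alpha> a + Ln (h z / h a)\<close>, which is differentiable.
\<close>

lemma entire_logarithm:
  fixes h :: "complex ^ 'm::finite \<Rightarrow> complex"
  assumes h: "entire h" and nz: "\<And>z. h z \<noteq> 0"
  obtains \<alpha> where "entire \<alpha>" "\<And>z. h z = exp (\<alpha> z)"
proof -
  obtain \<alpha> where cont: "continuous_on UNIV \<alpha>" and \<alpha>: "\<And>z. h z = exp (\<alpha> z)"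
    using continuous_logarithm_on_contractible[OF continuous_on_entire[OF h, of UNIV] convex_imp_contractible[OF convex_UNIV]] nz
    by auto
  have "entire \<alpha>"
    unfolding entire_def
  proof (intro allI exI conjI)
    fix a
    have d: "((\<lambda>z. \<alpha> a + Ln (h z / h a)) has_derivative (\<lambda>v. 1 / h a * dir_deriv v h a)) (at a)"
    proof (rule has_derivative_compose_entire[OF h, of "\<lambda>w. \<alpha> a + Ln (w / h a)"])
      show "((\<lambda>w. \<alpha> a + Ln (w / h a)) has_field_derivative 1 / h a) (at (h a))"
        using nz[of a] by (auto intro!: derivative_eq_intros simp: divide_simps)
    qed
    have "isCont \<alpha> a" using cont continuous_on_eq_continuous_at by blast
    then have "(\<alpha> \<longlongrightarrow> \<alpha> a) (nhds a)" by (simp add: isCont_def tendsto_at_iff_tendsto_nhds)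
    then have "\<forall>\<^sub>F z in nhds a. dist (\<alpha> z) (\<alpha> a) < pi" by (rule tendstoD) simp
    then have ev: "\<forall>\<^sub>F z in nhds a. \<alpha> a + Ln (h z / h a) = \<alpha> z"
    proof eventually_elim
      case (elim z)
      have "\<bar>Im (\<alpha> z - \<alpha> a)\<bar> < pi"
        using abs_Im_le_cmod[of "\<alpha> z - \<alpha> a"] elim by (simp add: dist_norm)
      then have "Ln (exp (\<alpha> z - \<alpha> a)) = \<alpha> z - \<alpha> a" by (intro Ln_exp) auto
      then show ?case by (simp add: \<alpha> exp_diff)
    qed
    show "(\<alpha> has_derivative (\<lambda>v. 1 / h a * dir_deriv v h a)) (at a)"
    proof (rule has_derivative_transform_eventually[OF d])
      show "\<forall>\<^sub>F z in at a. \<alpha> a + Ln (h z / h a) = \<alpha> z"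
        using ev by (simp add: eventually_at_filter eventually_mono)
    qed (use nz[of a] in auto)
  qed (simp add: dir_deriv_scale)
  then show ?thesis using \<alpha> that by blast
qed

section \<open>Restriction to lines\<close>

text \<open>
The line through \<open>a\<close> and \<open>z\<close> reduces this to one variable.
\<close>

lemma entire_no_zero_divisors_several:
  fixes A B :: "complex ^ 'm::finite \<Rightarrow> complex"
  assumes A: "entire A" and B: "entire B" and prod: "\<And>z. A z * B z = 0" and a: "A a \<noteq> 0"
  shows "B z = 0"
proof -
  have "(\<forall>t. A (a + t *s (z - a)) = 0) \<or> (\<forall>t. B (a + t *s (z - a)) = 0)"
    by (rule entire_no_zero_divisors[OF entire_on_line_holomorphic[OF A] entire_on_line_holomorphic[OF B] prod])
  moreover have "A (a + 0 *s (z - a)) \<noteq> 0" using a by simp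
  ultimately have "B (a + 1 *s (z - a)) = 0" by blast
  then show ?thesis by simp
qed

lemma shared_power_on_line:
  fixes f :: "complex ^ 'm::finite \<Rightarrow> complex"
  assumes f: "entire f" and n: "n \<ge> 2"
    and share: "\<And>z. f z ^ n = 1 \<longleftrightarrow> of_nat n * f z ^ (n - 1) * dir_deriv u f z = 1"
  shows "dir_deriv u f z * (f z - of_nat n * dir_deriv u f z) = 0"
proof -
  define g where "g t = f (z + t *s u)" for t
  have dg: "deriv g t = dir_deriv u f (z + t *s u)" for t
    unfolding g_def by (rule DERIV_imp_deriv[OF entire_on_line[OF f]])
  have g0: "g 0 = f z" by (simp add: g_def)
  have dg0: "deriv g 0 = dir_deriv u f z" by (simp add: dg)
  show ?thesis
  proof (cases "g constant_on UNIV")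
    case True
    then obtain c where "g = (\<lambda>_. c)" by (auto simp: constant_on_def)
    then have "deriv g 0 = 0" by simp
    then show ?thesis by (simp add: dg0)
  next
    case False
    have "shared_power g n"
    proof
      show "g holomorphic_on UNIV" unfolding g_def by (rule entire_on_line_holomorphic[OF f])
      show "g t ^ n = 1 \<longleftrightarrow> of_nat n * g t ^ (n - 1) * deriv g t = 1" for t
        unfolding dg unfolding g_def by (rule share)
    qed (fact n False)+
    then have "g 0 = of_nat n * deriv g 0" by (rule shared_power.eq_n_times_derivative)
    then show ?thesis by (simp add: g0 dg0)
  qed
qed

text \<open>
The product rule shows that \<open>f exp (- z\<^sub>j / n)\<close> is constant on the lines in direction \<open>u\<close>.
\<close>

lemma eq_exp_times_indep_of_coord:
  fixes f :: "complex ^ 'm::finite \<Rightarrow> complex"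
  assumes f: "entire f" and n: "n > 0" and u: "u $ j = 1" "\<And>i. i \<noteq> j \<Longrightarrow> u $ i = 0"
    and eq: "\<And>z. f z = of_nat n * dir_deriv u f z"
  obtains h where "entire h" "indep_of_coord j h" "\<And>z. f z = exp (z $ j / of_nat n) * h z"
proof -
  define h where "h z = f z * exp (- (z $ j / of_nat n))" for z
  have "((\<lambda>w. exp (- (w / of_nat n))) has_field_derivative exp (- (w / of_nat n)) * - (1 / of_nat n)) (at w)"
    for w :: complex using n by (auto intro!: derivative_eq_intros)
  from entire_mult[OF f entire_compose[OF entire_coord this, of j]]
  have h: "entire h" unfolding h_def .
  have fh: "f z = exp (z $ j / of_nat n) * h z" for z by (simp add: h_def exp_minus)
  have indep: "h z = h w" if zw: "\<And>i. i \<noteq> j \<Longrightarrow> z $ i = w $ i" for z w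
  proof -
    define q where "q t = f (w + t *s u) * exp (- ((w $ j + t) / of_nat n))" for t
    have comp: "(w + t *s u) $ j = w $ j + t" for t using u(1) by simp
    have q: "q t = h (w + t *s u)" for t by (simp only: q_def h_def comp)
    define b where "b = 1 / (of_nat n :: complex)"
    have bn: "b * of_nat n = 1" using n by (simp add: b_def)
    have d: "dir_deriv u f x = b * f x" for x
      by (subst eq) (simp only: mult.assoc[symmetric] bn mult_1_left)
    have e: "((\<lambda>t. exp (- ((w $ j + t) / of_nat n))) has_field_derivative
        exp (- ((w $ j + t) / of_nat n)) * - b) (at t)" for t
      unfolding b_def using n by (auto intro!: derivative_eq_intros)
    have zero: "b * x * y + y * - b * x = 0" for x y :: complex by simp
    have "(q has_field_derivative 0) (at t)" for t
      using DERIV_mult[OF entire_on_line[OF f, of w u t] e[of t]] unfolding q_def[abs_def] d zero .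
    then obtain c where "\<And>t. q t = c"
      using has_field_derivative_zero_constant[of UNIV q] by auto
    then have "q (z $ j - w $ j) = q 0" by simp
    moreover have "w + (z $ j - w $ j) *s u = z"
    proof (subst vec_eq_iff, intro allI)
      fix i
      show "(w + (z $ j - w $ j) *s u) $ i = z $ i"
        using u zw[of i] by (cases "i = j") simp_all
    qed
    moreover have "w + 0 *s u = w" by simp
    ultimately show ?thesis by (simp only: q)
  qed
  have "indep_of_coord j h" unfolding indep_of_coord_def by (intro allI impI indep) blast
  then show ?thesis by (rule that[OF h _ fh])
qed

text \<open>
Composing any entire logarithm of \<open>h\<close> with the projection that sets the \<open>j\<close>-th coordinate to 0 gives one that is
independent of that coordinate.
\<close>

lemma logarithm_indep_of_coord:
  fixes h :: "complex ^ 'm::finite \<Rightarrow> complex"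
  assumes h: "entire h" and indep: "indep_of_coord j h" and nz: "\<And>z. h z \<noteq> 0"
  obtains \<alpha> where "entire \<alpha>" "indep_of_coord j \<alpha>" "\<And>z. h z = exp (\<alpha> z)"
proof -
  obtain \<beta> where \<beta>: "entire \<beta>" "\<And>z. h z = exp (\<beta> z)" using entire_logarithm[OF h nz] by blast
  define l where "l z = (\<chi> i. if i = j then 0 else z $ i)" for z :: "complex ^ 'm"
  have lin: "bounded_linear l"
    by (rule bounded_linearI') (simp_all add: l_def vec_eq_iff)
  have "l (c *s v) = c *s l v" for c v by (simp add: l_def vec_eq_iff)
  then have ent: "entire (\<lambda>z. \<beta> (l z))" by (rule entire_compose_linear[OF \<beta>(1) lin])
  have l_eq: "l z = l w" if "\<forall>i. i \<noteq> j \<longrightarrow> z $ i = w $ i" for z w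
    using that by (simp add: l_def vec_eq_iff)
  have ind: "indep_of_coord j (\<lambda>z. \<beta> (l z))"
    unfolding indep_of_coord_def by (intro allI impI arg_cong[of _ _ \<beta>] l_eq) blast
  have "h z = exp (\<beta> (l z))" for z
  proof -
    have "\<forall>i. i \<noteq> j \<longrightarrow> z $ i = l z $ i" by (simp add: l_def)
    then have "h z = h (l z)" using indep unfolding indep_of_coord_def by blast
    then show ?thesis by (simp only: \<beta>(2)[symmetric])
  qed
  then show ?thesis by (rule that[OF ent ind])
qed

theorem theorem2p3:
  fixes u :: "complex ^ 'm::finite"
    and f :: "complex ^ 'm \<Rightarrow> complex"
    and n :: nat
  assumes "u \<in> complex_sphere"
    and "entire f"
    and "\<not> f constant_on UNIV"
    and "n \<ge> 2"
    and "\<exists>z. dir_deriv u (\<lambda>z. f z ^ n) z \<noteq> 0"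
    and "share_IM (\<lambda>z. f z ^ n) (dir_deriv u (\<lambda>z. f z ^ n)) 1"
  shows "(\<forall>z. f z = of_nat n * dir_deriv u f z) \<and>
    (\<forall>j. u $ j = 1 \<and> (\<forall>i. i \<noteq> j \<longrightarrow> u $ i = 0) \<longrightarrow>
       (\<exists>h. entire h \<and> indep_of_coord j h \<and> (\<forall>z. f z = exp (z $ j / of_nat n) * h z)) \<and>
       ((\<forall>z. f z \<noteq> 0) \<longrightarrow>
         (\<exists>\<alpha>. entire \<alpha> \<and> indep_of_coord j \<alpha> \<and>
            (\<forall>z. f z = exp (z $ j / of_nat n + \<alpha> z)) \<and>
            ((\<nexists>c. \<forall>z. f z = c * exp (z $ j / of_nat n)) \<longrightarrow> \<not> \<alpha> constant_on UNIV))))"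
proof -
  note f = \<open>entire f\<close> and n = \<open>n \<ge> 2\<close>
  have dpow: "dir_deriv u (\<lambda>z. f z ^ n) = (\<lambda>z. of_nat n * f z ^ (n - 1) * dir_deriv u f z)"
    by (rule ext) (rule dir_deriv_power[OF f])
  have share: "f z ^ n = 1 \<longleftrightarrow> of_nat n * f z ^ (n - 1) * dir_deriv u f z = 1" for z
    using iffD1[OF share_IM_iff[OF entire_power[OF f] entire_dir_deriv[OF entire_power[OF f]]] assms(6)]
    unfolding dpow by blast
  obtain a where a: "dir_deriv u f a \<noteq> 0" using assms(5) unfolding dpow by auto
  have "entire (\<lambda>z. f z - of_nat n * dir_deriv u f z)"
    by (intro entire_diff entire_mult entire_const entire_dir_deriv f)
  from entire_no_zero_divisors_several[OF entire_dir_deriv[OF f] this shared_power_on_line[OF f n share] a]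
  have eq: "f z = of_nat n * dir_deriv u f z" for z by (simp only: right_minus_eq)
  show ?thesis
  proof (intro conjI allI impI eq)
    fix j
    assume j: "u $ j = 1 \<and> (\<forall>i. i \<noteq> j \<longrightarrow> u $ i = 0)"
    obtain h where h: "entire h" "indep_of_coord j h" "\<And>z. f z = exp (z $ j / of_nat n) * h z"
      by (rule eq_exp_times_indep_of_coord[OF f _ _ _ eq, of j]) (use n j in auto)
    then show "\<exists>h. entire h \<and> indep_of_coord j h \<and> (\<forall>z. f z = exp (z $ j / of_nat n) * h z)" by blast
    assume "\<forall>z. f z \<noteq> 0"
    then have "h z \<noteq> 0" for z using h(3)[of z] by auto
    then obtain \<alpha> where \<alpha>: "entire \<alpha>" "indep_of_coord j \<alpha>" "\<And>z. h z = exp (\<alpha> z)"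
      using logarithm_indep_of_coord[OF h(1,2)] by blast
    have f\<alpha>: "f z = exp (z $ j / of_nat n + \<alpha> z)" for z by (simp add: h(3) \<alpha>(3) exp_add)
    have "\<not> \<alpha> constant_on UNIV" if "\<nexists>c. \<forall>z. f z = c * exp (z $ j / of_nat n)"
    proof
      assume "\<alpha> constant_on UNIV"
      then obtain c where "\<And>z. \<alpha> z = c" by (auto simp: constant_on_def)
      then have "f z = exp c * exp (z $ j / of_nat n)" for z by (simp add: f\<alpha> exp_add)
      with that show False by blast
    qed
    with \<alpha>(1,2) f\<alpha> show "\<exists>\<alpha>. entire \<alpha> \<and> indep_of_coord j \<alpha> \<and>
            (\<forall>z. f z = exp (z $ j / of_nat n + \<alpha> z)) \<and>
            ((\<nexists>c. \<forall>z. f z = c * exp (z $ j / of_nat n)) \<longrightarrow> \<not> \<alpha> constant_on UNIV)"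
      by blast
  qed
qed

end
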